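(* Let $\alpha\in(1,2)$, $\sigma>0$, and assume the Standing Assumption. Let $\mu_0$ be a probability measure on $\mathbb{R}^p$ with finite first moment. For $n\ge1$ and $\eta>0$, let $\hat\theta^{i,n}_0$, $i\le n$, be i.i.d. with law $\mu_0$, let $X^{i,n}_k$ ($i\le n$, $k\ge0$) be i.i.d. copies of $\mathrm{L}_1$ for an $\alpha$-stable Lévy process $\mathrm{L}$ of Type-I, II or III, independent of the initialization, and define \[ \hat\theta^{i,n}_{k+1}=\hat\theta^{i,n}_k-\eta n\,\partial_{\theta^{i,n}}R(\hat\Theta^n_k)+\sigma\eta^{1/\alpha}X^{i,n}_k, \] where $\hat\Theta^n_k\in\mathbb{R}^{p\times n}$ has columns $\hat\theta^{1,n}_k,\dots,\hat\theta^{n,n}_k$. For $\kappa\in(0,1)$, let $\hat\Theta^{(\kappa n)}_k$ be obtained from $\hat\Theta^n_k$ by keeping the $\lfloor\kappa n\rfloor$ columns with largest Euclidean norms and setting all other columns to zero. Then for every $t>0$, $\kappa\in(0,1)$ and every sufficiently small $\epsilon>0$ there exists $N\in\mathbb{N}$ such that for all $n\ge N$ and all $\eta\le n^{-\alpha/2-1}$, with probability at least $1-\epsilon$, \[ \frac{\big\|\hat\Theta^{(\kappa n)}_{\lfloor t/\eta\rfloor}-\hat\Theta^n_{\lfloor t/\eta\rfloor}\big\|_F}{\big\|\hat\Theta^n_{\lfloor t/\eta\rfloor}\big\|_F}\le\epsilon. \]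
   Context: Data distribution $\pi$ on $\mathcal{X}\times\mathcal{Y}$, $\mathcal{X}\subset\mathbb{R}^d$; models $h_x:\mathbb{R}^p\to\mathbb{R}^l$; loss $\ell:\mathbb{R}^l\times\mathcal{Y}\to\mathbb{R}_+$. The mean-field network with parameters $\Theta^n=(\theta^{1,n},\dots,\theta^{n,n})\in\mathbb{R}^{p\times n}$ is $f_{\Theta^n}(x)=\frac1n\sum_{i=1}^nh_x(\theta^{i,n})$, and the risk is $R(\Theta^n)=\mathbb{E}_{(x,y)\sim\pi}[\ell(f_{\Theta^n}(x),y)]$. $\|\cdot\|_F$ is the Frobenius norm. Standing Assumption: each $h_x$ is twice differentiable with $\|h_x\|_\infty+\|\nabla h_x\|_\infty+\|\nabla^2h_x\|_\infty\le\Psi(x)$; $\|\partial_1\ell(\cdot,y)\|_\infty+\|\partial_1^2\ell(\cdot,y)\|_\infty\le\Phi(y)$ (derivatives in the first argument); and $\mathbb{E}_{\pi}[\Psi(x)^2(1+\Phi(y)^2)]\le B^2$ for some $B>0$. An $\alpha$-stable Lévy process $(\mathrm{L}_t)$ in $\mathbb{R}^p$ is a stochastically continuous process with $\mathrm{L}_0=0$, independent increments, and $\mathrm{L}_t-\mathrm{L}_s\overset{d}{=}(t-s)^{1/\alpha}\mathrm{L}_1$; Type-I: $\mathrm{L}_1=\mathbf{1}_pZ$ with $Z$ real symmetric $\alpha$-stable ($\mathbb{E}e^{i\omega Z}=e^{-|\omega|^\alpha}$); Type-II: $\mathrm{L}_1$ has i.i.d. such coordinates; Type-III: $\mathbb{E}e^{i\langle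 u,\mathrm{L}_1\rangle}=e^{-\|u\|^\alpha}$. *)

theory Defs
  imports "HOL-Probability.Probability"
begin

text \<open>Mean-field network f_Theta(x) = (1/n) sum_{i<n} h_x(theta^i); columns of Theta are Theta 0, ..., Theta (n-1).\<close>
definition mf_net :: "('x \<Rightarrow> real^'p \<Rightarrow> real^'l) \<Rightarrow> nat \<Rightarrow> (nat \<Rightarrow> real^'p) \<Rightarrow> 'x \<Rightarrow> real^'l" where
  "mf_net h n W x = (1 / real n) *\<^sub>R (\<Sum>i<n. h x (W i))"

definition risk :: "('x \<times> 'y) measure \<Rightarrow> ('x \<Rightarrow> real^'p \<Rightarrow> real^'l) \<Rightarrow> (real^'l \<Rightarrow> 'y \<Rightarrow> real)
    \<Rightarrow> nat \<Rightarrow> (nat \<Rightarrow> real^'p) \<Rightarrow> real" where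
  "risk \<pi> h loss n W = (\<integral>xy. loss (mf_net h n W (fst xy)) (snd xy) \<partial>\<pi>)"

definition risk_pgrad :: "('x \<times> 'y) measure \<Rightarrow> ('x \<Rightarrow> real^'p \<Rightarrow> real^'l) \<Rightarrow> (real^'l \<Rightarrow> 'y \<Rightarrow> real)
    \<Rightarrow> nat \<Rightarrow> (nat \<Rightarrow> real^'p) \<Rightarrow> nat \<Rightarrow> real^'p" where
  "risk_pgrad \<pi> h loss n W i = (THE D. GDERIV (\<lambda>\<theta>. risk \<pi> h loss n (W(i := \<theta>))) (W i) :> D)"

primrec sgd_traj :: "('x \<times> 'y) measure \<Rightarrow> ('x \<Rightarrow> real^'p \<Rightarrow> real^'l) \<Rightarrow> (real^'l \<Rightarrow> 'y \<Rightarrow> real)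
    \<Rightarrow> real \<Rightarrow> real \<Rightarrow> nat \<Rightarrow> real \<Rightarrow> (nat \<Rightarrow> real^'p) \<Rightarrow> (nat \<Rightarrow> nat \<Rightarrow> real^'p)
    \<Rightarrow> nat \<Rightarrow> (nat \<Rightarrow> real^'p)" where
  "sgd_traj \<pi> h loss \<alpha> \<sigma> n \<eta> W0 Xs 0 = W0"
| "sgd_traj \<pi> h loss \<alpha> \<sigma> n \<eta> W0 Xs (Suc k) =
     (\<lambda>i. sgd_traj \<pi> h loss \<alpha> \<sigma> n \<eta> W0 Xs k i
          - (\<eta> * real n) *\<^sub>R risk_pgrad \<pi> h loss n (sgd_traj \<pi> h loss \<alpha> \<sigma> n \<eta> W0 Xs k) i
          + (\<sigma> * \<eta> powr (1 / \<alpha>)) *\<^sub>R Xs k i)"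

definition frob :: "nat \<Rightarrow> (nat \<Rightarrow> real^'p) \<Rightarrow> real" where
  "frob n W = sqrt (\<Sum>i<n. (norm (W i))\<^sup>2)"

text \<open>Keep the m columns (among the first n) with largest Euclidean norms, set all others to zero.
  (Ties are broken arbitrarily; the Frobenius distance to Theta does not depend on the choice.)\<close>
definition top_cols :: "nat \<Rightarrow> nat \<Rightarrow> (nat \<Rightarrow> real^'p) \<Rightarrow> nat set" where
  "top_cols n m W = (SOME S. S \<subseteq> {..<n} \<and> card S = m \<and>
       (\<forall>i\<in>S. \<forall>j\<in>{..<n} - S. norm (W j) \<le> norm (W i)))"

definition trunc_top :: "nat \<Rightarrow> nat \<Rightarrow> (nat \<Rightarrow> real^'p) \<Rightarrow> (nat \<Rightarrow> real^'p)" where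
  "trunc_top n m W = (\<lambda>i. if i \<in> top_cols n m W then W i else 0)"

definition charfun :: "'a::euclidean_space measure \<Rightarrow> 'a \<Rightarrow> complex" where
  "charfun M u = (CLINT x|M. cis (u \<bullet> x))"

definition sym_stable :: "real \<Rightarrow> real measure \<Rightarrow> bool" where
  "sym_stable \<alpha> Z \<longleftrightarrow> prob_space Z \<and> sets Z = sets borel \<and>
     (\<forall>w. charfun Z w = complex_of_real (exp (- (\<bar>w\<bar> powr \<alpha>))))"

text \<open>Laws of L_1 for the three types of alpha-stable Levy processes.\<close>
definition stable_typeI :: "real \<Rightarrow> (real^'p) measure \<Rightarrow> bool" where
  "stable_typeI \<alpha> L \<longleftrightarrow> (\<exists>Z. sym_stable \<alpha> Z \<and> L = distr Z borel (\<lambda>z. \<chi> j. z))"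

definition stable_typeII :: "real \<Rightarrow> (real^'p) measure \<Rightarrow> bool" where
  "stable_typeII \<alpha> L \<longleftrightarrow>
     (\<exists>Z. sym_stable \<alpha> Z \<and> L = distr (PiM UNIV (\<lambda>j::'p. Z)) borel (\<lambda>z. \<chi> j. z j))"

definition stable_typeIII :: "real \<Rightarrow> (real^'p) measure \<Rightarrow> bool" where
  "stable_typeIII \<alpha> L \<longleftrightarrow> prob_space L \<and> sets L = sets borel \<and>
     (\<forall>u. charfun L u = complex_of_real (exp (- (norm u powr \<alpha>))))"

end

theory Submission
  imports Defs
begin

text \<open>
  Every rescaled gradient \<open>n \<partial>\<^sub>iR\<close> is bounded by a constant \<open>C\<close>, so up to time \<open>t\<close> each column stays
  within \<open>C t\<close> of the independent walk \<open>\<theta>\<^sub>0\<^sup>i + \<sigma> \<eta>\<^bsup>1/\<alpha>\<^esup> \<Sum>\<^sub>k X\<^sup>i\<^sub>k\<close>; the interaction between the columns needs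
  no finer control. Each coordinate of the noise part of the walk is exactly \<open>\<alpha>\<close>-stable of scale about
  \<open>\<sigma> t\<^bsup>1/\<alpha>\<^esup>\<close>. Hence the walks are tight, and by Markov's inequality at most \<open>\<kappa> n\<close> columns exceed some
  level \<open>q\<close>, which bounds the truncation error by \<open>\<surd>n q\<close>. On the other hand the second moment is
  infinite: \<open>1 - e\<^bsup>-c|w|^\<alpha>\<^esup>\<close> is much larger than \<open>w\<^sup>2\<close> as \<open>w\<close> tends to 0, so truncated squares have
  arbitrarily large mean, and by Hoeffding's inequality the squared Frobenius norm exceeds any
  prescribed multiple of \<open>n\<close>.
\<close>

section \<open>Truncation to the largest columns\<close>

text \<open>A set of \<open>m\<close> columns maximising the sum of the norms has the required
  property: exchanging a member for a strictly larger outside column would increase the sum. For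
  \<open>m \<le> n\<close> the choice in \<open>top_cols\<close> is therefore never vacuous.\<close>

lemma top_cols_spec:
  assumes "m \<le> n"
  shows "top_cols n m W \<subseteq> {..<n} \<and> card (top_cols n m W) = m \<and>
    (\<forall>i\<in>top_cols n m W. \<forall>j\<in>{..<n} - top_cols n m W. norm (W j) \<le> norm (W i))"
proof -
  let ?F = "{S. S \<subseteq> {..<n} \<and> card S = m}"
  have fin: "finite ?F" by (rule finite_subset[of _ "Pow {..<n}"]) auto
  have "{..<m} \<in> ?F" using assms by auto
  then have ne: "?F \<noteq> {}" by blast
  define g where "g S = (\<Sum>i\<in>S. norm (W i))" for S
  have "Max (g ` ?F) \<in> g ` ?F" using fin ne by (intro Max_in) auto
  then obtain S where SM: "Max (g ` ?F) = g S" and S: "S \<in> ?F" by (rule imageE)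
  have mx: "g S' \<le> g S" if "S' \<in> ?F" for S'
    unfolding SM[symmetric] using that fin by (intro Max_ge) auto
  have finS: "finite S" using S by (auto intro: finite_subset[of _ "{..<n}"])
  have "norm (W j) \<le> norm (W i)" if ij: "i \<in> S" "j \<in> {..<n} - S" for i j
  proof -
    have "insert j (S - {i}) \<in> ?F" using S ij finS card_Suc_Diff1[OF finS ij(1)]
      by auto
    then have "g (insert j (S - {i})) \<le> g S" by (rule mx)
    moreover have "g (insert j (S - {i})) = norm (W j) + (g S - norm (W i))"
      unfolding g_def using ij finS by (simp add: sum_diff1)
    ultimately show ?thesis by simp
  qed
  then have "S \<subseteq> {..<n} \<and> card S = m \<and> (\<forall>i\<in>S. \<forall>j\<in>{..<n} - S. norm (W j) \<le> norm (W i))"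
    using S by blast
  then show ?thesis
    unfolding top_cols_def by (rule someI)
qed

lemma frob_trunc_top:
  assumes "m \<le> n"
  shows "frob n (\<lambda>i. trunc_top n m W i - W i) =
    sqrt (\<Sum>i\<in>{..<n} - top_cols n m W. (norm (W i))\<^sup>2)"
proof -
  have "(\<Sum>i<n. (norm (trunc_top n m W i - W i))\<^sup>2) =
      (\<Sum>i\<in>{..<n} - top_cols n m W. (norm (trunc_top n m W i - W i))\<^sup>2)"
    by (rule sum.mono_neutral_right) (auto simp: trunc_top_def)
  also have "\<dots> = (\<Sum>i\<in>{..<n} - top_cols n m W. (norm (W i))\<^sup>2)"
    by (rule sum.cong) (auto simp: trunc_top_def)
  finally show ?thesis by (simp add: frob_def)
qed

text \<open>The differences \<open>S - S'\<close> and \<open>S' - S\<close> have equal size, so a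
  bijection pairs each element of \<open>S' - S\<close> with a dominating element of
  \<open>S - S'\<close>; the common part cancels.\<close>

lemma sum_le_sum_top:
  fixes g :: "'a \<Rightarrow> real"
  assumes "finite S" "finite S'" "card S = card S'"
    and "\<And>i j. i \<in> S \<Longrightarrow> j \<in> S' - S \<Longrightarrow> g j \<le> g i"
  shows "sum g S' \<le> sum g S"
proof -
  have "card (S - S') = card (S' - S)"
    using card_le_sym_Diff[of S S'] card_le_sym_Diff[of S' S] assms by auto
  then obtain f where f: "bij_betw f (S' - S) (S - S')"
    using assms by (metis finite_Diff finite_same_card_bij)
  have "sum g (S' - S) \<le> (\<Sum>j\<in>S' - S. g (f j))"
    using assms(4) f by (intro sum_mono) (auto simp: bij_betw_def)
  also have "\<dots> = sum g (S - S')" by (rule sum.reindex_bij_betw[OF f])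
  finally show ?thesis
    using sum.Int_Diff[of S g S'] sum.Int_Diff[of S' g S] assms(1,2) by (simp add: Int_commute)
qed

text \<open>Expressing the truncation error without the choice operator makes it visibly measurable.\<close>
lemma frob_trunc_top_eq_Min:
  assumes "m \<le> n"
  shows "frob n (\<lambda>i. trunc_top n m W i - W i) =
    Min ((\<lambda>S. sqrt (\<Sum>i\<in>{..<n} - S. (norm (W i))\<^sup>2)) ` {S. S \<subseteq> {..<n} \<and> card S = m})"
proof -
  let ?T = "top_cols n m W" and ?g = "\<lambda>i. (norm (W i))\<^sup>2"
  note T = top_cols_spec[OF assms, of W]
  have fin: "finite ((\<lambda>S. sqrt (\<Sum>i\<in>{..<n} - S. ?g i)) ` {S. S \<subseteq> {..<n} \<and> card S = m})"
    by (rule finite_imageI, rule finite_subset[of _ "Pow {..<n}"]) auto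
  have le: "(\<Sum>i\<in>{..<n} - ?T. ?g i) \<le> (\<Sum>i\<in>{..<n} - S. ?g i)"
    if "S \<subseteq> {..<n}" "card S = m" for S
  proof -
    have "sum ?g S \<le> sum ?g ?T"
      using that T by (intro sum_le_sum_top power_mono) (auto dest: finite_subset[OF _ finite_lessThan])
    then show ?thesis
      using that T by (simp add: sum_diff)
  qed
  show ?thesis
    unfolding frob_trunc_top[OF assms] using T le
    by (intro Min_eqI[symmetric] fin) auto
qed

lemma measurable_frob_trunc_top:
  fixes W :: "'w \<Rightarrow> nat \<Rightarrow> real^'p"
  assumes "m \<le> n" and [measurable]: "\<And>i. i < n \<Longrightarrow> (\<lambda>\<omega>. W \<omega> i) \<in> borel_measurable M"
  shows "(\<lambda>\<omega>. frob n (\<lambda>i. trunc_top n m (W \<omega>) i - W \<omega> i)) \<in> borel_measurable M"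
  unfolding frob_trunc_top_eq_Min[OF assms(1)]
proof (rule borel_measurable_Min)
  show "finite {S. S \<subseteq> {..<n} \<and> card S = m}"
    by (rule finite_subset[of _ "Pow {..<n}"]) auto
  show "(\<lambda>\<omega>. sqrt (\<Sum>i\<in>{..<n} - S. (norm (W \<omega> i))\<^sup>2)) \<in> borel_measurable M" for S
    by measurable
qed

text \<open>A discarded column above \<open>q\<close> would force all \<open>m\<close> kept columns
  above \<open>q\<close> as well, hence \<open>m + 1\<close> columns above \<open>q\<close>.\<close>

lemma frob_trunc_top_le:
  assumes "m \<le> n" "0 \<le> q" and count: "card {i. i < n \<and> q < norm (W i)} \<le> m"
  shows "frob n (\<lambda>i. trunc_top n m W i - W i) \<le> sqrt (real n) * q"
proof -
  let ?T = "top_cols n m W"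
  note T = top_cols_spec[OF assms(1), of W]
  have le: "norm (W j) \<le> q" if j: "j \<in> {..<n} - ?T" for j
  proof (rule ccontr)
    assume "\<not> ?thesis"
    then have "insert j ?T \<subseteq> {i. i < n \<and> q < norm (W i)}"
      using T j by force
    then have "card (insert j ?T) \<le> m"
      using count card_mono[of "{i. i < n \<and> q < norm (W i)}" "insert j ?T"] by auto
    moreover have "card (insert j ?T) = Suc m"
      using T j finite_subset[of ?T "{..<n}"] by auto
    ultimately show False by simp
  qed
  have "(\<Sum>i\<in>{..<n} - ?T. (norm (W i))\<^sup>2) \<le> (\<Sum>i\<in>{..<n} - ?T. q\<^sup>2)"
    by (intro sum_mono power_mono le) auto
  also have "\<dots> \<le> (\<Sum>i<n. q\<^sup>2)" by (intro sum_mono2) auto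
  finally have "sqrt (\<Sum>i\<in>{..<n} - ?T. (norm (W i))\<^sup>2) \<le> sqrt (real n * q\<^sup>2)" by simp
  then show ?thesis
    using assms by (simp add: frob_trunc_top real_sqrt_mult)
qed

lemma truncation_ratio_le:
  assumes "m \<le> n" "0 < q" "0 < \<epsilon>" and "card {i. i < n \<and> q < norm (W i)} \<le> m"
    and large: "real n * (q / \<epsilon>)\<^sup>2 \<le> (\<Sum>i<n. (norm (W i))\<^sup>2)"
  shows "frob n (\<lambda>i. trunc_top n m W i - W i) / frob n W \<le> \<epsilon>"
\<comment> \<open>If the norm vanishes, the quotient is 0 by the convention for division by
  zero.\<close>
proof (cases "frob n W = 0")
  case False
  then have pos: "0 < frob n W"
    by (simp add: frob_def sum_nonneg order_less_le)
  have "frob n (\<lambda>i. trunc_top n m W i - W i) \<le> sqrt (real n) * q"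
    using assms by (intro frob_trunc_top_le) auto
  also have "\<dots> = \<epsilon> * sqrt (real n * (q / \<epsilon>)\<^sup>2)"
    using \<open>0 < q\<close> \<open>0 < \<epsilon>\<close> by (simp add: real_sqrt_mult real_sqrt_divide)
  also have "\<dots> \<le> \<epsilon> * frob n W"
    using large \<open>0 < \<epsilon>\<close> unfolding frob_def by (intro mult_left_mono real_sqrt_le_mono) auto
  finally show ?thesis using pos by (simp add: divide_le_eq)
qed (use \<open>0 < \<epsilon>\<close> in simp)

text \<open>Lower bounds survive the restriction to one coordinate and the truncation at
  \<open>b\<close>. The displacement \<open>D\<close> is paid for by
  \<open>(x + y)^2 \<le> 2 x^2 + 2 y^2\<close>, which turns \<open>A / 2\<close> into
  \<open>A / 4\<close>.\<close>

lemma sum_norm_square_ge: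
  fixes W H :: "nat \<Rightarrow> real^'p"
  assumes close: "\<And>i. i < n \<Longrightarrow> norm (W i - H i) \<le> D"
    and large: "real n * A / 2 \<le> (\<Sum>i<n. min ((H i $ c)\<^sup>2) b)"
  shows "real n * (A / 4 - D\<^sup>2) \<le> (\<Sum>i<n. (norm (W i))\<^sup>2)"
proof -
  have "min ((H i $ c)\<^sup>2) b / 2 - D\<^sup>2 \<le> (norm (W i))\<^sup>2" if "i < n" for i
  proof -
    have "\<bar>H i $ c\<bar> \<le> \<bar>W i $ c\<bar> + \<bar>(W i - H i) $ c\<bar>" by simp
    also have "\<dots> \<le> norm (W i) + D"
      using component_le_norm_cart[of "W i" c] component_le_norm_cart[of "W i - H i" c] close[OF that]
      by linarith
    finally have "(H i $ c)\<^sup>2 \<le> (norm (W i) + D)\<^sup>2"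
      by (rule order_trans[OF eq_refl[OF power2_abs[symmetric]] power_mono]) simp
    also have "\<dots> \<le> 2 * (norm (W i))\<^sup>2 + 2 * D\<^sup>2"
      using zero_le_power2[of "norm (W i) - D"] by (simp add: power2_eq_square algebra_simps)
    finally show ?thesis by linarith
  qed
  then have "(\<Sum>i<n. min ((H i $ c)\<^sup>2) b / 2 - D\<^sup>2) \<le> (\<Sum>i<n. (norm (W i))\<^sup>2)"
    by (intro sum_mono) auto
  moreover have "(\<Sum>i<n. min ((H i $ c)\<^sup>2) b / 2 - D\<^sup>2) = (\<Sum>i<n. min ((H i $ c)\<^sup>2) b) / 2 - real n * D\<^sup>2"
    by (simp add: sum_subtractf sum_divide_distrib)
  ultimately show ?thesis using large by (simp add: algebra_simps)
qed

section \<open>Differentiation under the integral\<close>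

text \<open>The derivative in direction \<open>v\<close> is the pointwise limit of difference
  quotients with steps \<open>1 / (i + 1)\<close>, each measurable in \<open>w\<close>.\<close>

lemma borel_measurable_has_derivative:
  fixes g :: "'a::real_normed_vector \<Rightarrow> 'w \<Rightarrow> real"
  assumes meas: "\<And>b. g b \<in> borel_measurable M"
    and deriv: "\<And>w. w \<in> space M \<Longrightarrow> ((\<lambda>b. g b w) has_derivative G w) (at a)"
  shows "(\<lambda>w. G w v) \<in> borel_measurable M"
proof (rule borel_measurable_LIMSEQ_real)
  show "(\<lambda>w. (g (a + inverse (real (Suc i)) *\<^sub>R v) w - g a w) / inverse (real (Suc i))) \<in> borel_measurable M" for i
    using meas by measurable
  fix w assume w: "w \<in> space M"
  have "((\<lambda>s. g (a + s *\<^sub>R v) w) has_derivative (\<lambda>s. G w (s *\<^sub>R v))) (at (0::real))"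
    by (rule has_derivative_compose[where f="\<lambda>s. a + s *\<^sub>R v" and g="\<lambda>b. g b w"])
       (auto intro!: derivative_eq_intros deriv[OF w])
  moreover have "G w (s *\<^sub>R v) = G w v * s" for s
    using linear_scale[OF has_derivative_linear[OF deriv[OF w]]] by simp
  ultimately have "((\<lambda>s. g (a + s *\<^sub>R v) w) has_real_derivative G w v) (at 0)"
    unfolding has_field_derivative_def by simp
  then have lim: "((\<lambda>s. (g (a + s *\<^sub>R v) w - g a w) / s) \<longlongrightarrow> G w v) (at 0)"
    by (simp add: has_field_derivative_iff)
  show "(\<lambda>i. (g (a + inverse (real (Suc i)) *\<^sub>R v) w - g a w) / inverse (real (Suc i))) \<longlonglongrightarrow> G w v"
    by (rule filterlim_compose[OF lim])
       (use LIMSEQ_inverse_real_of_nat in \<open>simp add: filterlim_at del: of_nat_Suc\<close>)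
qed

text \<open>Every difference quotient in direction \<open>v\<close> is at most
  \<open>L * norm v\<close> in absolute value, and the bound passes to the limit.\<close>

lemma has_derivative_abs_le_Lipschitz:
  fixes f :: "'a::real_normed_vector \<Rightarrow> real"
  assumes deriv: "(f has_derivative f') (at a)"
    and lip: "\<And>b. \<bar>f b - f a\<bar> \<le> L * norm (b - a)"
  shows "\<bar>f' v\<bar> \<le> L * norm v"
proof -
  have "((\<lambda>s. f (a + s *\<^sub>R v)) has_derivative (\<lambda>s. f' (s *\<^sub>R v))) (at (0::real))"
    by (rule has_derivative_compose[where f="\<lambda>s. a + s *\<^sub>R v" and g=f])
       (auto intro!: derivative_eq_intros deriv)
  moreover have "f' (s *\<^sub>R v) = f' v * s" for s
    using linear_scale[OF has_derivative_linear[OF deriv]] by simp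
  ultimately have "((\<lambda>s. f (a + s *\<^sub>R v)) has_real_derivative f' v) (at 0)"
    unfolding has_field_derivative_def by simp
  then have "((\<lambda>s. (f (a + s *\<^sub>R v) - f a) / s) \<longlongrightarrow> f' v) (at 0)"
    by (simp add: has_field_derivative_iff)
  then have "((\<lambda>s. \<bar>(f (a + s *\<^sub>R v) - f a) / s\<bar>) \<longlongrightarrow> \<bar>f' v\<bar>) (at 0)"
    by (rule tendsto_rabs)
  moreover have "\<forall>\<^sub>F s in at (0::real). \<bar>(f (a + s *\<^sub>R v) - f a) / s\<bar> \<le> L * norm v"
    unfolding eventually_at_topological
  proof (intro exI[of _ UNIV] conjI ballI impI)
    fix s :: real assume "s \<noteq> 0"
    have "\<bar>f (a + s *\<^sub>R v) - f a\<bar> \<le> L * (\<bar>s\<bar> * norm v)"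
      using lip[of "a + s *\<^sub>R v"] by simp
    with \<open>s \<noteq> 0\<close> show "\<bar>(f (a + s *\<^sub>R v) - f a) / s\<bar> \<le> L * norm v"
      by (simp add: abs_divide divide_le_eq mult_ac)
  qed auto
  ultimately show ?thesis by (rule tendsto_upperbound) simp
qed

text \<open>Dominated convergence along sequences tending to \<open>a\<close>. The normalised
  remainder is dominated by \<open>2 * K\<close>: one \<open>K\<close> bounds the increment of
  \<open>g\<close>, the other the linear part \<open>G\<close>.\<close>

lemma has_derivative_integral:
  fixes g :: "'a::euclidean_space \<Rightarrow> 'w \<Rightarrow> real"
  assumes int: "\<And>b. integrable M (g b)"
    and deriv: "\<And>w. ((\<lambda>b. g b w) has_derivative G w) (at a)"
    and lip: "\<And>w b. \<bar>g b w - g a w\<bar> \<le> K w * norm (b - a)"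
    and K: "integrable M K"
  shows "((\<lambda>b. \<integral>w. g b w \<partial>M) has_derivative (\<lambda>v. \<integral>w. G w v \<partial>M)) (at a)"
proof -
  have lin: "linear (G w)" for w
    using deriv has_derivative_linear by blast
  have G_le: "\<bar>G w v\<bar> \<le> K w * norm v" for w v
    by (rule has_derivative_abs_le_Lipschitz[OF deriv lip])
  have [measurable]: "(\<lambda>w. G w v) \<in> borel_measurable M" for v
    using int deriv by (intro borel_measurable_has_derivative) auto
  have int_G: "integrable M (\<lambda>w. G w v)" for v
    by (rule Bochner_Integration.integrable_bound[OF integrable_mult_left[OF K, of "norm v"]])
       (auto intro!: AE_I2 order_trans[OF G_le])
  let ?A = "\<lambda>v. \<integral>w. G w v \<partial>M"
  have "bounded_linear ?A"
  proof (rule bounded_linear_intro[where K="\<integral>w. K w \<partial>M"])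
    show "?A (x + y) = ?A x + ?A y" for x y
      using int_G by (simp add: linear_add[OF lin])
    show "?A (r *\<^sub>R x) = r *\<^sub>R ?A x" for r x
      by (simp add: linear_scale[OF lin])
    show "norm (?A x) \<le> norm x * (\<integral>w. K w \<partial>M)" for x
    proof -
      have "norm (?A x) \<le> (\<integral>w. \<bar>G w x\<bar> \<partial>M)"
        using integral_norm_bound[of M "\<lambda>w. G w x"] by simp
      also have "\<dots> \<le> (\<integral>w. K w * norm x \<partial>M)"
        using int_G K G_le by (intro integral_mono) auto
      finally show ?thesis by (simp add: mult.commute)
    qed
  qed
  moreover have "((\<lambda>y. ((\<integral>w. g y w \<partial>M) - (\<integral>w. g a w \<partial>M) - ?A (y - a)) /\<^sub>R norm (y - a)) \<longlongrightarrow> 0) (at a)"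
    unfolding tendsto_at_iff_sequentially comp_def
  proof (intro allI impI)
    fix X assume X: "\<forall>i. X i \<in> UNIV - {a}" "X \<longlonglongrightarrow> a"
    define D where "D i w = (g (X i) w - g a w - G w (X i - a)) /\<^sub>R norm (X i - a)" for i w
    have eq: "((\<integral>w. g (X i) w \<partial>M) - (\<integral>w. g a w \<partial>M) - ?A (X i - a)) /\<^sub>R norm (X i - a) = (\<integral>w. D i w \<partial>M)" for i
      unfolding D_def using int int_G by simp
    have "(\<lambda>i. \<integral>w. D i w \<partial>M) \<longlonglongrightarrow> (\<integral>w. 0 \<partial>M)"
    proof (rule integral_dominated_convergence[where w="\<lambda>w. 2 * K w"])
      show "D i \<in> borel_measurable M" for i
        unfolding D_def using int by measurable
      show "integrable M (\<lambda>w. 2 * K w)" using K by simp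
      show "AE w in M. (\<lambda>i. D i w) \<longlonglongrightarrow> 0"
        using deriv X unfolding has_derivative_at_within tendsto_at_iff_sequentially comp_def D_def
        by (intro AE_I2) blast
      show "AE w in M. norm (D i w) \<le> 2 * K w" for i
      proof (rule AE_I2)
        fix w
        have "\<bar>g (X i) w - g a w - G w (X i - a)\<bar> \<le> 2 * K w * norm (X i - a)"
          using lip[of "X i" w] G_le[of w "X i - a"] by linarith
        moreover have "norm (X i - a) > 0" using X by auto
        ultimately show "norm (D i w) \<le> 2 * K w"
          by (simp add: D_def abs_mult field_simps)
      qed
    qed simp
    then show "(\<lambda>i. ((\<integral>w. g (X i) w \<partial>M) - (\<integral>w. g a w \<partial>M) - ?A (X i - a)) /\<^sub>R norm (X i - a)) \<longlonglongrightarrow> 0"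
      by (simp only: eq Bochner_Integration.integral_zero)
  qed
  ultimately show ?thesis unfolding has_derivative_at_within by blast
qed

lemma has_derivative_imp_GDERIV:
  fixes f :: "'a::euclidean_space \<Rightarrow> real"
  assumes "(f has_derivative f') (at a)"
  shows "GDERIV f a :> (\<Sum>b\<in>Basis. f' b *\<^sub>R b)"
proof -
  have lin: "linear f'" using assms has_derivative_linear by blast
  have "f' v = v \<bullet> (\<Sum>b\<in>Basis. f' b *\<^sub>R b)" for v
  proof -
    have "f' v = f' (\<Sum>b\<in>Basis. (v \<bullet> b) *\<^sub>R b)" by (simp add: euclidean_representation)
    also have "\<dots> = (\<Sum>b\<in>Basis. (v \<bullet> b) * f' b)" by (simp add: linear_sum[OF lin] linear_scale[OF lin])
    finally show ?thesis by (simp add: inner_sum_right mult.commute)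
  qed
  then have "f' = (\<lambda>v. v \<bullet> (\<Sum>b\<in>Basis. f' b *\<^sub>R b))" by blast
  then show ?thesis using assms by (simp add: gderiv_def)
qed

text \<open>Supplies the uniqueness behind the definite description in
  \<open>risk_pgrad\<close>.\<close>

lemma GDERIV_unique:
  assumes "GDERIV f a :> D" "GDERIV f a :> D'"
  shows "D = D'"
proof -
  have "(\<lambda>v. v \<bullet> D) = (\<lambda>v. v \<bullet> D')"
    using assms has_derivative_unique unfolding gderiv_def by blast
  then show ?thesis by (simp add: fun_eq_iff vector_eq_ldot)
qed

section \<open>The gradient of the mean-field risk\<close>

locale mean_field_risk =
  fixes \<pi> :: "('x \<times> 'y) measure"
    and h :: "'x \<Rightarrow> real^'p \<Rightarrow> real^'l"
    and Dh :: "'x \<Rightarrow> real^'p \<Rightarrow> ((real^'p) \<Rightarrow>\<^sub>L (real^'l))"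
    and loss :: "real^'l \<Rightarrow> 'y \<Rightarrow> real"
    and Dl :: "'y \<Rightarrow> real^'l \<Rightarrow> ((real^'l) \<Rightarrow>\<^sub>L real)"
    and \<Psi> :: "'x \<Rightarrow> real" and \<Phi> :: "'y \<Rightarrow> real" and B :: real
  assumes pi_prob: "prob_space \<pi>"
    and h_D1: "\<And>x \<theta>. (h x has_derivative blinfun_apply (Dh x \<theta>)) (at \<theta>)"
    and Dh_le: "\<And>x \<theta>. norm (Dh x \<theta>) \<le> \<Psi> x"
    and l_D1: "\<And>y z. ((\<lambda>w. loss w y) has_derivative blinfun_apply (Dl y z)) (at z)"
    and Dl_le: "\<And>y z. norm (Dl y z) \<le> \<Phi> y"
    and moment_int: "integrable \<pi> (\<lambda>xy. (\<Psi> (fst xy))\<^sup>2 * (1 + (\<Phi> (snd xy))\<^sup>2))"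
    and moment_bound: "(\<integral>xy. (\<Psi> (fst xy))\<^sup>2 * (1 + (\<Phi> (snd xy))\<^sup>2) \<partial>\<pi>) \<le> B\<^sup>2"
    and risk_finite: "\<And>n W. integrable \<pi> (\<lambda>xy. loss (mf_net h n W (fst xy)) (snd xy))"
begin

text \<open>The product \<open>\<Psi> \<Phi>\<close> need not be measurable, so it is replaced by a measurable majorant.\<close>
definition "K xy = (1 + (\<Psi> (fst xy))\<^sup>2 * (1 + (\<Phi> (snd xy))\<^sup>2)) / 2"

text \<open>Bounds the integral of \<open>K\<close> and, in \<open>risk_pgrad_le\<close>, the
  gradients rescaled by \<open>n\<close>, uniformly in \<open>n\<close> and in the
  parameters.\<close>

definition "C = (1 + B\<^sup>2) / 2"

lemma C_pos: "0 < C"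
  unfolding C_def by (simp add: add_pos_nonneg)

lemma integrable_K: "integrable \<pi> K"
proof -
  interpret prob_space \<pi> by (rule pi_prob)
  show ?thesis unfolding K_def[abs_def] using moment_int by auto
qed

lemma integral_K_le: "(\<integral>xy. K xy \<partial>\<pi>) \<le> C"
proof -
  interpret prob_space \<pi> by (rule pi_prob)
  show ?thesis
    unfolding K_def C_def using moment_int moment_bound by (simp add: prob_space)
qed

lemma Phi_nonneg: "0 \<le> \<Phi> y"
  using Dl_le norm_ge_zero order_trans by blast

lemma Phi_Psi_le_K: "\<Phi> y * \<Psi> x \<le> K (x, y)"
proof -
  \<comment> \<open>Expanding gives
    \<open>2 \<Phi> \<Psi> \<le> 1 + \<Psi>^2 (1 + \<Phi>^2)\<close>, whose right-hand side is
    \<open>2 K\<close>.\<close>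
  have "0 \<le> (\<Phi> y * \<Psi> x - 1)\<^sup>2 + (\<Psi> x)\<^sup>2" by simp
  then show ?thesis unfolding K_def by (simp add: power2_eq_square algebra_simps)
qed

section \<open>Lipschitz estimates for the network and the risk\<close>

lemma h_lipschitz: "norm (h x a - h x b) \<le> \<Psi> x * norm (a - b)"
  by (rule differentiable_bound[where S=UNIV and f'="\<lambda>\<theta>. blinfun_apply (Dh x \<theta>)"])
     (auto simp: h_D1 Dh_le norm_blinfun.rep_eq[symmetric])

lemma loss_lipschitz: "\<bar>loss u y - loss v y\<bar> \<le> \<Phi> y * norm (u - v)"
  using differentiable_bound[where S=UNIV and f="\<lambda>w. loss w y" and f'="\<lambda>\<theta>. blinfun_apply (Dl y \<theta>)" and B="\<Phi> y"]
  by (auto simp: l_D1 Dl_le norm_blinfun.rep_eq[symmetric])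

text \<open>Averaging gives each column the weight \<open>1 / n\<close>; this later cancels the
  factor \<open>n\<close> in the update.\<close>

lemma mf_net_lipschitz:
  "norm (mf_net h n W x - mf_net h n W' x) \<le> \<Psi> x * ((\<Sum>i<n. norm (W i - W' i)) / real n)"
proof -
  have "norm (\<Sum>i<n. h x (W i) - h x (W' i)) \<le> (\<Sum>i<n. \<Psi> x * norm (W i - W' i))"
    by (rule sum_norm_le) (rule h_lipschitz)
  then have "norm (\<Sum>i<n. h x (W i) - h x (W' i)) / n \<le> (\<Psi> x * (\<Sum>i<n. norm (W i - W' i))) / n"
    by (intro divide_right_mono) (auto simp: sum_distrib_left)
  then show ?thesis
    unfolding mf_net_def by (simp add: scaleR_diff_right[symmetric] sum_subtractf[symmetric])
qed

lemma net_loss_lipschitz: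
  "\<bar>loss (mf_net h n W (fst xy)) (snd xy) - loss (mf_net h n W' (fst xy)) (snd xy)\<bar>
    \<le> K xy * ((\<Sum>i<n. norm (W i - W' i)) / real n)"
proof -
  let ?s = "(\<Sum>i<n. norm (W i - W' i)) / real n"
  have "\<bar>loss (mf_net h n W (fst xy)) (snd xy) - loss (mf_net h n W' (fst xy)) (snd xy)\<bar>
      \<le> \<Phi> (snd xy) * (\<Psi> (fst xy) * ?s)"
    by (rule order_trans[OF loss_lipschitz mult_left_mono[OF mf_net_lipschitz Phi_nonneg]])
  also have "\<dots> = (\<Phi> (snd xy) * \<Psi> (fst xy)) * ?s" by (simp add: mult.assoc)
  also have "\<dots> \<le> K xy * ?s"
    using Phi_Psi_le_K[of "snd xy" "fst xy"] by (intro mult_right_mono) (auto intro!: divide_nonneg_nonneg sum_nonneg)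
  finally show ?thesis .
qed

lemma risk_lipschitz:
  "\<bar>risk \<pi> h loss n W - risk \<pi> h loss n W'\<bar> \<le> C * ((\<Sum>i<n. norm (W i - W' i)) / real n)"
proof -
  let ?s = "(\<Sum>i<n. norm (W i - W' i)) / real n"
  let ?f = "\<lambda>W xy. loss (mf_net h n W (fst xy)) (snd xy)"
  have "\<bar>risk \<pi> h loss n W - risk \<pi> h loss n W'\<bar> = \<bar>\<integral>xy. ?f W xy - ?f W' xy \<partial>\<pi>\<bar>"
    unfolding risk_def by (subst Bochner_Integration.integral_diff) (auto simp: risk_finite)
  also have "\<dots> \<le> (\<integral>xy. \<bar>?f W xy - ?f W' xy\<bar> \<partial>\<pi>)"
    by (rule integral_abs_bound)
  also have "\<dots> \<le> (\<integral>xy. K xy * ?s \<partial>\<pi>)"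
    by (intro integral_mono net_loss_lipschitz integrable_abs Bochner_Integration.integrable_diff risk_finite
        integrable_mult_left integrable_K)
  also have "\<dots> = (\<integral>xy. K xy \<partial>\<pi>) * ?s" by simp
  also have "\<dots> \<le> C * ?s"
    by (intro mult_right_mono integral_K_le divide_nonneg_nonneg sum_nonneg) auto
  finally show ?thesis .
qed

text \<open>Reduces the joint Lipschitz estimates to the displacement of a single column.\<close>

lemma sum_norm_fun_upd:
  fixes W :: "nat \<Rightarrow> real^'p"
  assumes "i < n"
  shows "(\<Sum>j<n. norm ((W(i := a)) j - (W(i := b)) j)) = norm (a - b)"
proof -
  have "(\<Sum>j<n. norm ((W(i := a)) j - (W(i := b)) j)) = (\<Sum>j<n. if j = i then norm (a - b) else 0)"
    by (rule sum.cong) auto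
  then show ?thesis using assms by simp
qed

section \<open>Existence and size of the partial gradients\<close>

lemma mf_net_has_derivative:
  assumes "i < n"
  shows "((\<lambda>\<theta>. mf_net h n (W(i := \<theta>)) x) has_derivative (\<lambda>v. (1 / real n) *\<^sub>R Dh x a v)) (at a)"
proof -
  have "mf_net h n (W(i := \<theta>)) x = (1 / real n) *\<^sub>R (h x \<theta> + (\<Sum>j\<in>{..<n} - {i}. h x (W j)))" for \<theta>
    unfolding mf_net_def using assms
    by (subst sum.remove[of _ i]) (auto intro!: arg_cong[where f="\<lambda>z. _ *\<^sub>R (_ + z)"] sum.cong)
  then show ?thesis
    by (auto intro!: derivative_eq_intros h_D1)
qed

text \<open>Existence comes from differentiating under the integral with the majorant
  \<open>K / n\<close>; uniqueness of gradients then identifies the definite description.\<close>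

lemma risk_pgrad_GDERIV:
  assumes "i < n"
  shows "GDERIV (\<lambda>\<theta>. risk \<pi> h loss n (W(i := \<theta>))) (W i) :> risk_pgrad \<pi> h loss n W i"
proof -
  let ?g = "\<lambda>\<theta> xy. loss (mf_net h n (W(i := \<theta>)) (fst xy)) (snd xy)"
  \<comment> \<open>The trivial update \<open>W(i := W i)\<close> is kept so that the formula
    matches the output of the chain rule.\<close>
  let ?G = "\<lambda>xy v. Dl (snd xy) (mf_net h n (W(i := W i)) (fst xy)) ((1 / real n) *\<^sub>R Dh (fst xy) (W i) v)"
  have "((\<lambda>\<theta>. \<integral>xy. ?g \<theta> xy \<partial>\<pi>) has_derivative (\<lambda>v. \<integral>xy. ?G xy v \<partial>\<pi>)) (at (W i))"
  proof (rule has_derivative_integral[where K="\<lambda>xy. K xy / real n"])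
    show "integrable \<pi> (?g \<theta>)" for \<theta> by (rule risk_finite)
    show "((\<lambda>\<theta>. ?g \<theta> xy) has_derivative ?G xy) (at (W i))" for xy
      by (rule has_derivative_compose[OF mf_net_has_derivative[OF assms] l_D1])
    show "\<bar>?g \<theta> xy - ?g (W i) xy\<bar> \<le> K xy / real n * norm (\<theta> - W i)" for xy \<theta>
      using net_loss_lipschitz[of n "W(i := \<theta>)" xy "W(i := W i)"]
      unfolding sum_norm_fun_upd[OF assms] by simp
    show "integrable \<pi> (\<lambda>xy. K xy / real n)"
      using integrable_K by simp
  qed
  then have "\<exists>D. GDERIV (\<lambda>\<theta>. risk \<pi> h loss n (W(i := \<theta>))) (W i) :> D"
    unfolding risk_def using has_derivative_imp_GDERIV by blast
  then show ?thesis
    unfolding risk_pgrad_def by (metis (no_types, lifting) GDERIV_unique theI)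
qed

text \<open>In each column the risk is Lipschitz with constant \<open>C / n\<close>. Testing the
  derivative on the gradient itself bounds its squared norm by \<open>C / n\<close> times its
  norm.\<close>

lemma risk_pgrad_le:
  assumes "i < n"
  shows "norm (real n *\<^sub>R risk_pgrad \<pi> h loss n W i) \<le> C"
proof -
  let ?D = "risk_pgrad \<pi> h loss n W i"
  have "\<bar>?D \<bullet> ?D\<bar> \<le> (C / real n) * norm ?D"
  proof (rule has_derivative_abs_le_Lipschitz[where a="W i" and v="?D" and f'="\<lambda>v. v \<bullet> ?D"
        and f="\<lambda>\<theta>. risk \<pi> h loss n (W(i := \<theta>))"])
    show "((\<lambda>\<theta>. risk \<pi> h loss n (W(i := \<theta>))) has_derivative (\<lambda>v. v \<bullet> ?D)) (at (W i))"
      using risk_pgrad_GDERIV[OF assms] by (simp add: gderiv_def)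
    show "\<bar>risk \<pi> h loss n (W(i := b)) - risk \<pi> h loss n (W(i := W i))\<bar> \<le> C / real n * norm (b - W i)" for b
      using risk_lipschitz[of n "W(i := b)" "W(i := W i)"]
      unfolding sum_norm_fun_upd[OF assms] by simp
  qed
  then have "norm ?D * norm ?D \<le> (C / real n) * norm ?D"
    by (simp add: power2_norm_eq_inner[symmetric] power2_eq_square)
  then have "norm ?D \<le> C / real n"
    using C_pos by (cases "?D = 0") (auto simp del: times_divide_eq_left dest: mult_right_le_imp_le)
  then show ?thesis using assms by (simp add: field_simps)
qed

section \<open>Measurability of the random trajectory\<close>

lemma continuous_on_risk: "continuous_on UNIV (risk \<pi> h loss n)"
  unfolding continuous_on_def
proof
  fix W :: "nat \<Rightarrow> real^'p"
  have coord: "((\<lambda>V. V i) \<longlongrightarrow> W i) (at W)" for i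
  proof -
    have "continuous_on UNIV (\<lambda>V::nat \<Rightarrow> real^'p. V i)"
      by (rule continuous_on_product_coordinates)
    then show ?thesis unfolding continuous_on_def by simp
  qed
  have "((\<lambda>V. \<Sum>i<n. norm (V i - W i)) \<longlongrightarrow> (\<Sum>i<n. norm (W i - W i))) (at W)"
    by (intro tendsto_sum tendsto_norm tendsto_diff coord tendsto_const)
  then have lim: "((\<lambda>V. C * ((\<Sum>i<n. norm (V i - W i)) / real n)) \<longlongrightarrow> 0) (at W)"
    by (intro tendsto_mult_right_zero tendsto_divide_zero) simp
  have "((\<lambda>V. risk \<pi> h loss n V - risk \<pi> h loss n W) \<longlongrightarrow> 0) (at W)"
    by (rule Lim_null_comparison[OF _ lim]) (use risk_lipschitz in \<open>simp add: always_eventually\<close>)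
  then show "(risk \<pi> h loss n \<longlongrightarrow> risk \<pi> h loss n W) (at W)"
    by (simp add: Lim_null[symmetric])
qed

text \<open>Continuity of the risk in the product topology suffices, because the product
  sigma-algebra on sequences of columns is the Borel one.\<close>

lemma measurable_risk:
  assumes [measurable]: "\<And>i. i < n \<Longrightarrow> (\<lambda>\<omega>. W \<omega> i) \<in> borel_measurable M"
  shows "(\<lambda>\<omega>. risk \<pi> h loss n (W \<omega>)) \<in> borel_measurable M"
proof -
  \<comment> \<open>Measurability is known for the first \<open>n\<close> columns only, and the risk
    reads no others; the rest are set to 0.\<close>
  let ?V = "\<lambda>\<omega> i. if i < n then W \<omega> i else 0"
  have "?V \<in> M \<rightarrow>\<^sub>M PiM UNIV (\<lambda>_::nat. borel)"
  proof (rule measurable_PiM_single')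
    show "(\<lambda>\<omega>. ?V \<omega> j) \<in> borel_measurable M" for j
      by (cases "j < n") simp_all
  qed auto
  then have V: "?V \<in> borel_measurable M"
    using measurable_cong_sets[OF refl sets_PiM_equal_borel, of M] by auto
  have "(\<lambda>\<omega>. risk \<pi> h loss n (?V \<omega>)) \<in> borel_measurable M"
    by (rule measurable_compose[OF V borel_measurable_continuous_onI[OF continuous_on_risk]])
  moreover have "risk \<pi> h loss n (?V \<omega>) = risk \<pi> h loss n (W \<omega>)" for \<omega>
  proof -
    have "mf_net h n (?V \<omega>) x = mf_net h n (W \<omega>) x" for x
      unfolding mf_net_def by (intro arg_cong[where f="scaleR _"] sum.cong) auto
    then show ?thesis unfolding risk_def by simp
  qed
  ultimately show ?thesis by simp
qed

lemma measurable_risk_pgrad: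
  assumes W: "\<And>i. i < n \<Longrightarrow> (\<lambda>\<omega>. W \<omega> i) \<in> borel_measurable M" and "i < n"
  shows "(\<lambda>\<omega>. risk_pgrad \<pi> h loss n (W \<omega>) i) \<in> borel_measurable M"
proof (rule borel_measurable_euclidean_space[THEN iffD2], rule ballI)
  fix v :: "real^'p" assume "v \<in> Basis"
  \<comment> \<open>The shift by \<open>b\<close> moves the base point to 0:
    \<open>borel_measurable_has_derivative\<close> requires one that does not depend on the
    sample.\<close>
  let ?g = "\<lambda>b \<omega>. risk \<pi> h loss n ((W \<omega>)(i := W \<omega> i + b))"
  have "(\<lambda>\<omega>. v \<bullet> risk_pgrad \<pi> h loss n (W \<omega>) i) \<in> borel_measurable M"
  proof (rule borel_measurable_has_derivative[where g="?g" and a=0 and v=v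
        and G="\<lambda>\<omega> v. v \<bullet> risk_pgrad \<pi> h loss n (W \<omega>) i"])
    show "?g b \<in> borel_measurable M" for b
    proof (rule measurable_risk)
      fix j assume "j < n"
      show "(\<lambda>\<omega>. ((W \<omega>)(i := W \<omega> i + b)) j) \<in> borel_measurable M"
        using W[OF \<open>j < n\<close>] W[OF \<open>i < n\<close>]
        by (cases "j = i") (simp_all add: borel_measurable_add)
    qed
    show "((\<lambda>b. ?g b \<omega>) has_derivative (\<lambda>v. v \<bullet> risk_pgrad \<pi> h loss n (W \<omega>) i)) (at 0)" for \<omega>
    proof -
      have "((\<lambda>b. W \<omega> i + b) has_derivative (\<lambda>v. v)) (at 0)"
        by (auto intro!: derivative_eq_intros)
      moreover have "((\<lambda>\<theta>. risk \<pi> h loss n ((W \<omega>)(i := \<theta>))) has_derivative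
          (\<lambda>v. v \<bullet> risk_pgrad \<pi> h loss n (W \<omega>) i)) (at (W \<omega> i + 0))"
        using risk_pgrad_GDERIV[OF \<open>i < n\<close>, of "W \<omega>"] by (simp add: gderiv_def)
      ultimately show ?thesis by (rule has_derivative_compose)
    qed
  qed
  then show "(\<lambda>\<omega>. risk_pgrad \<pi> h loss n (W \<omega>) i \<bullet> v) \<in> borel_measurable M"
    by (simp add: inner_commute)
qed

lemma measurable_sgd_traj:
  assumes W0: "\<And>i. i < n \<Longrightarrow> (\<lambda>\<omega>. W0 \<omega> i) \<in> borel_measurable M"
    and X: "\<And>i k. i < n \<Longrightarrow> (\<lambda>\<omega>. X \<omega> k i) \<in> borel_measurable M"
    and "i < n"
  shows "(\<lambda>\<omega>. sgd_traj \<pi> h loss \<alpha> \<sigma> n \<eta> (W0 \<omega>) (X \<omega>) k i) \<in> borel_measurable M"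
  using \<open>i < n\<close>
proof (induction k arbitrary: i)
  case 0
  then show ?case using W0 by simp
next
  case (Suc k)
  show ?case
    unfolding sgd_traj.simps using Suc X
    by (intro borel_measurable_add borel_measurable_diff borel_measurable_scaleR borel_measurable_const
        measurable_risk_pgrad) auto
qed

text \<open>The noise is additive, so subtracting the walk removes it exactly. What remains is a sum
  of \<open>k\<close> gradient steps, each of norm at most \<open>\<eta> * C\<close>; the estimate
  is pathwise.\<close>

lemma sgd_traj_drift_le:
  assumes "i < n" "0 < \<eta>"
  shows "norm (sgd_traj \<pi> h loss \<alpha> \<sigma> n \<eta> W0 X k i
      - (W0 i + (\<Sum>j<k. (\<sigma> * \<eta> powr (1 / \<alpha>)) *\<^sub>R X j i))) \<le> C * (real k * \<eta>)"
proof (induction k)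
  case (Suc k)
  let ?W = "sgd_traj \<pi> h loss \<alpha> \<sigma> n \<eta> W0 X k"
  let ?e = "?W i - (W0 i + (\<Sum>j<k. (\<sigma> * \<eta> powr (1 / \<alpha>)) *\<^sub>R X j i))"
  let ?d = "\<eta> *\<^sub>R (real n *\<^sub>R risk_pgrad \<pi> h loss n ?W i)"
  have "norm (?e - ?d) \<le> norm ?e + norm ?d" by (rule norm_triangle_ineq4)
  also have "norm ?d = \<eta> * norm (real n *\<^sub>R risk_pgrad \<pi> h loss n ?W i)"
    using assms by (simp only: norm_scaleR abs_of_pos)
  also have "norm ?e + \<dots> \<le> C * (real k * \<eta>) + \<eta> * C"
    using assms by (intro add_mono Suc.IH mult_left_mono risk_pgrad_le) auto
  finally show ?case by (simp add: algebra_simps)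
qed simp

end

section \<open>Stable laws and tail bounds\<close>

text \<open>Tightness of a single random variable: the events decrease to the empty set, so
  continuity from above applies.\<close>

lemma (in prob_space) prob_abs_gt_small:
  fixes f :: "'a \<Rightarrow> real"
  assumes [measurable]: "f \<in> borel_measurable M" and "0 < \<delta>"
  obtains q where "0 < q" "prob {x\<in>space M. q < \<bar>f x\<bar>} < \<delta>"
proof -
  let ?A = "\<lambda>n. {x\<in>space M. real n < \<bar>f x\<bar>}"
  have "(\<lambda>n. prob (?A n)) \<longlonglongrightarrow> prob (\<Inter>n. ?A n)"
    by (rule finite_Lim_measure_decseq) (auto simp: decseq_def)
  moreover have "(\<Inter>n. ?A n) = {}"
  proof -
    have "\<exists>n. \<not> real n < \<bar>f x\<bar>" for x
      using real_arch_simple[of "\<bar>f x\<bar>"] by (auto simp: not_less)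
    then show ?thesis by blast
  qed
  ultimately have "(\<lambda>n. prob (?A n)) \<longlonglongrightarrow> 0" by simp
  then have "\<forall>\<^sub>F n in sequentially. prob (?A n) < \<delta>"
    using \<open>0 < \<delta>\<close> by (rule order_tendstoD)
  then obtain N where N: "\<And>n. n \<ge> N \<Longrightarrow> prob (?A n) < \<delta>"
    unfolding eventually_sequentially by blast
  \<comment> \<open>\<open>Suc N\<close> in place of \<open>N\<close> keeps the level
    positive.\<close>
  show thesis
    by (rule that[of "real (Suc N)"]) (use N[of "Suc N"] in simp_all)
qed

lemma one_minus_cos_le:
  fixes y :: real
  shows "1 - cos y \<le> y\<^sup>2 / 2"
proof -
  have "cos (2 * (y / 2)) = 1 - 2 * (sin (y / 2))\<^sup>2" by (rule cos_double_sin)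
  then have "1 - cos y = 2 * (sin (y / 2))\<^sup>2" by simp
  moreover have "\<bar>sin (y / 2)\<bar> \<le> \<bar>y / 2\<bar>" by (rule abs_sin_x_le_abs_x)
  then have "(sin (y / 2))\<^sup>2 \<le> (y / 2)\<^sup>2" by (simp only: abs_le_square_iff)
  ultimately show ?thesis by (simp add: power_divide)
qed

text \<open>\<open>1 - cos (w X)\<close> is at most both \<open>(w X)^2 / 2\<close> and 2, hence at
  most \<open>w^2 / 2\<close> times the truncated square. Passing from the real part to the modulus
  lets independent factors be estimated separately later.\<close>

lemma (in prob_space) expectation_min_square_ge:
  assumes [measurable]: "X \<in> borel_measurable M" and "0 < w"
  shows "2 / w\<^sup>2 * (1 - cmod (char (distr M borel X) w)) \<le> expectation (\<lambda>x. min ((X x)\<^sup>2) (4 / w\<^sup>2))"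
proof -
  have int: "integrable M (\<lambda>x. iexp (w * X x))"
    by (rule integrable_const_bound[where B=1]) auto
  have int_cos: "integrable M (\<lambda>x. cos (w * X x))"
    by (rule integrable_const_bound[where B=1]) auto
  have int_min: "integrable M (\<lambda>x. min ((X x)\<^sup>2) (4 / w\<^sup>2))"
    by (rule integrable_const_bound[where B="4 / w\<^sup>2"]) auto
  have "char (distr M borel X) w = expectation (\<lambda>x. iexp (w * X x))"
    unfolding char_def by (subst integral_distr) auto
  then have "Re (char (distr M borel X) w) = expectation (\<lambda>x. cos (w * X x))"
    using int by (simp add: integral_Re[symmetric] Re_exp del: integral_Re)
  then have "1 - Re (char (distr M borel X) w) = expectation (\<lambda>x. 1 - cos (w * X x))"
    using int_cos by (simp add: prob_space)
  also have "\<dots> \<le> expectation (\<lambda>x. w\<^sup>2 / 2 * min ((X x)\<^sup>2) (4 / w\<^sup>2))"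
  proof (rule integral_mono)
    fix x
    have "1 - cos (w * X x) \<le> w\<^sup>2 / 2 * (X x)\<^sup>2"
      using one_minus_cos_le[of "w * X x"] by (simp add: power_mult_distrib)
    moreover have "1 - cos (w * X x) \<le> w\<^sup>2 / 2 * (4 / w\<^sup>2)"
      using cos_ge_minus_one[of "w * X x"] \<open>0 < w\<close> by simp
    ultimately show "1 - cos (w * X x) \<le> w\<^sup>2 / 2 * min ((X x)\<^sup>2) (4 / w\<^sup>2)"
      unfolding min_def by presburger
  qed (use int_cos int_min in auto)
  also have "\<dots> = w\<^sup>2 / 2 * expectation (\<lambda>x. min ((X x)\<^sup>2) (4 / w\<^sup>2))" by simp
  finally have "1 - cmod (char (distr M borel X) w) \<le> w\<^sup>2 / 2 * expectation (\<lambda>x. min ((X x)\<^sup>2) (4 / w\<^sup>2))"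
    using complex_Re_le_cmod[of "char (distr M borel X) w"] by linarith
  then show ?thesis
    using \<open>0 < w\<close> by (simp add: field_simps)
qed

section \<open>Characteristic functions of the coordinates of the noise\<close>

lemma charfun_real: "charfun M w = char M w"
  unfolding charfun_def char_def by (simp add: cis_conv_exp)

lemma sym_stable_char:
  assumes "sym_stable \<alpha> Z"
  shows "char Z w = exp (- (\<bar>w\<bar> powr \<alpha>))"
  using assms charfun_real[of Z w] by (simp add: sym_stable_def)

lemma borel_measurable_vec_lambda:
  fixes f :: "'w \<Rightarrow> 'p::finite \<Rightarrow> real"
  assumes "\<And>j. (\<lambda>x. f x j) \<in> borel_measurable M"
  shows "(\<lambda>x. \<chi> j. f x j) \<in> borel_measurable M"
proof (rule borel_measurable_euclidean_space[THEN iffD2], rule ballI)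
  fix b :: "real^'p" assume "b \<in> Basis"
  then obtain j where "b = axis j 1" by (auto simp: Basis_vec_def)
  then show "(\<lambda>x. (\<chi> j. f x j) \<bullet> b) \<in> borel_measurable M"
    using assms[of j] by (simp add: inner_axis)
qed

lemma borel_measurable_vec_nth [measurable]: "(\<lambda>x::real^'p. x $ j) \<in> borel_measurable borel"
  by (intro borel_measurable_continuous_onI continuous_intros)

text \<open>The joint law of the coordinates of the noise, in which the three types differ, plays no role.\<close>
lemma stable_type_coordinate:
  fixes L :: "(real^'p) measure"
  assumes "stable_typeI \<alpha> L \<or> stable_typeII \<alpha> L \<or> stable_typeIII \<alpha> L"
  shows "prob_space L" "sets L = sets borel"
    and "char (distr L borel (\<lambda>x. x $ j)) w = exp (- (\<bar>w\<bar> powr \<alpha>))"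
proof -
  have "prob_space L \<and> sets L = sets borel \<and>
    char (distr L borel (\<lambda>x. x $ j)) w = exp (- (\<bar>w\<bar> powr \<alpha>))"
    using assms
  proof (elim disjE)
    assume "stable_typeI \<alpha> L"
    then obtain Z where Z: "sym_stable \<alpha> Z" and L: "L = distr Z borel (\<lambda>z. \<chi> j. z)"
      by (auto simp: stable_typeI_def)
    have [measurable_cong]: "sets Z = sets borel" and "prob_space Z"
      using Z by (auto simp: sym_stable_def)
    have m: "(\<lambda>z. \<chi> j. z) \<in> Z \<rightarrow>\<^sub>M (borel :: (real^'p) measure)"
      by (rule borel_measurable_vec_lambda) measurable
    have "distr L borel (\<lambda>x. x $ j) = distr Z borel (\<lambda>z. z)"
      unfolding L by (subst distr_distr[OF _ m]) (auto simp: comp_def)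
    also have "\<dots> = Z" by (rule distr_id2) (simp add: \<open>sets Z = sets borel\<close>)
    finally show ?thesis
      using sym_stable_char[OF Z] prob_space.prob_space_distr[OF \<open>prob_space Z\<close> m] L by simp
  next
    assume "stable_typeII \<alpha> L"
    then obtain Z where Z: "sym_stable \<alpha> Z"
      and L: "L = distr (PiM UNIV (\<lambda>j::'p. Z)) borel (\<lambda>z. \<chi> j. z j)"
      by (auto simp: stable_typeII_def)
    have [measurable_cong]: "sets Z = sets borel" and "prob_space Z"
      using Z by (auto simp: sym_stable_def)
    have m: "(\<lambda>z. \<chi> j. z j) \<in> PiM UNIV (\<lambda>j::'p. Z) \<rightarrow>\<^sub>M (borel :: (real^'p) measure)"
      by (rule borel_measurable_vec_lambda) measurable
    have "distr L borel (\<lambda>x. x $ j) = distr (PiM UNIV (\<lambda>j::'p. Z)) borel (\<lambda>z. z j)"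
      unfolding L by (subst distr_distr[OF _ m]) (auto simp: comp_def)
    also have "\<dots> = distr (PiM UNIV (\<lambda>j::'p. Z)) Z (\<lambda>z. z j)"
      by (rule distr_cong) (simp_all add: \<open>sets Z = sets borel\<close>)
    also have "\<dots> = Z" using \<open>prob_space Z\<close> by (intro distr_PiM_component) auto
    finally have "distr L borel (\<lambda>x. x $ j) = Z" .
    moreover have "prob_space L"
      unfolding L using \<open>prob_space Z\<close> by (intro prob_space.prob_space_distr[OF prob_space_PiM m])
    ultimately show ?thesis
      using sym_stable_char[OF Z] L by simp
  next
    assume L: "stable_typeIII \<alpha> L"
    then have [measurable_cong]: "sets L = sets borel" and "prob_space L"
      by (auto simp: stable_typeIII_def)
    have "char (distr L borel (\<lambda>x. x $ j)) w = (CLINT x|L. iexp (w * x $ j))"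
      unfolding char_def by (subst integral_distr) auto
    also have "\<dots> = charfun L (axis j w)"
      unfolding charfun_def by (simp add: cis_conv_exp inner_axis' )
    also have "\<dots> = exp (- (\<bar>w\<bar> powr \<alpha>))"
      using L by (simp add: stable_typeIII_def norm_eq_sqrt_inner[of "axis j w"] inner_axis_axis)
    finally show ?thesis using \<open>sets L = sets borel\<close> \<open>prob_space L\<close> by simp
  qed
  then show "prob_space L" "sets L = sets borel"
    "char (distr L borel (\<lambda>x. x $ j)) w = exp (- (\<bar>w\<bar> powr \<alpha>))" by auto
qed

lemma char_distr_scale:
  assumes [measurable]: "X \<in> borel_measurable M"
  shows "char (distr M borel (\<lambda>x. c * X x)) w = char (distr M borel X) (c * w)"
  unfolding char_def by (simp add: integral_distr mult_ac)

text \<open>By uniqueness of characteristic functions, \<open>S\<close> is distributed as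
  \<open>c powr (1 / \<alpha>)\<close> times a variable with law \<open>Z\<close>. Scaling the level
  by the upper bound \<open>d\<close> makes the estimate uniform over all
  \<open>c \<le> d\<close>.\<close>

lemma (in prob_space) stable_tail_le:
  assumes [measurable]: "S \<in> borel_measurable M"
    and S: "\<And>w. char (distr M borel S) w = exp (- (c * \<bar>w\<bar> powr \<alpha>))"
    and Z: "real_distribution Z" "\<And>w. char Z w = exp (- (\<bar>w\<bar> powr \<alpha>))"
    and "0 < \<alpha>" "0 < c" "c \<le> d" "0 < q"
  shows "prob {x\<in>space M. q * d powr (1 / \<alpha>) < \<bar>S x\<bar>} \<le> measure Z {z. q < \<bar>z\<bar>}"
proof -
  interpret Z: real_distribution Z by (rule Z)
  let ?r = "c powr (1 / \<alpha>)"
  have r: "0 < ?r" "?r \<le> d powr (1 / \<alpha>)"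
    using \<open>0 < c\<close> \<open>c \<le> d\<close> \<open>0 < \<alpha>\<close> by (auto intro: powr_mono2)
  have "distr M borel S = distr Z borel (\<lambda>z. ?r * z)"
  proof (rule Levy_uniqueness)
    show "real_distribution (distr M borel S)" by (rule real_distribution_distr) simp
    show "real_distribution (distr Z borel (\<lambda>z. ?r * z))" by (rule Z.real_distribution_distr) simp
    have "char (distr Z borel (\<lambda>z. ?r * z)) w = exp (- (c * \<bar>w\<bar> powr \<alpha>))" for w
    proof -
      have "char (distr Z borel (\<lambda>z. ?r * z)) w = char (distr Z borel (\<lambda>z. z)) (?r * w)"
        by (rule char_distr_scale) simp
      also have "distr Z borel (\<lambda>z. z) = Z" by (rule distr_id2) simp
      also have "\<bar>?r * w\<bar> powr \<alpha> = c * \<bar>w\<bar> powr \<alpha>"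
        using \<open>0 < c\<close> \<open>0 < \<alpha>\<close> by (simp add: abs_mult powr_mult powr_powr)
      then have "char Z (?r * w) = exp (- (c * \<bar>w\<bar> powr \<alpha>))" by (simp add: Z(2))
      finally show ?thesis .
    qed
    then show "char (distr M borel S) = char (distr Z borel (\<lambda>z. ?r * z))"
      using S by (simp add: fun_eq_iff)
  qed
  then have "measure (distr M borel S) {y. q * d powr (1 / \<alpha>) < \<bar>y\<bar>} =
      measure (distr Z borel (\<lambda>z. ?r * z)) {y. q * d powr (1 / \<alpha>) < \<bar>y\<bar>}" by simp
  also have "\<dots> = measure Z {z. q * d powr (1 / \<alpha>) < \<bar>?r * z\<bar>}"
    by (subst measure_distr) (auto intro!: arg_cong[where f="measure Z"])
  also have "\<dots> \<le> measure Z {z. q < \<bar>z\<bar>}"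
  proof (rule Z.finite_measure_mono)
    show "{z. q * d powr (1 / \<alpha>) < \<bar>?r * z\<bar>} \<subseteq> {z. q < \<bar>z\<bar>}"
    proof
      fix z assume "z \<in> {z. q * d powr (1 / \<alpha>) < \<bar>?r * z\<bar>}"
      then have "q * ?r < ?r * \<bar>z\<bar>"
        using mult_left_mono[OF r(2), of q] r(1) \<open>0 < q\<close> unfolding mem_Collect_eq abs_mult by linarith
      then have "?r * q < ?r * \<bar>z\<bar>" by (simp only: mult.commute)
      then show "z \<in> {z. q < \<bar>z\<bar>}" using r(1) by (simp only: mult_less_cancel_left_pos mem_Collect_eq)
    qed
  qed simp
  finally show ?thesis
    by (subst (asm) measure_distr) (auto simp: vimage_def Int_def conj_commute)
qed

text \<open>Hoeffding's inequality for a deviation of \<open>n A / 2\<close>, at most half of the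
  mean: the exponent is \<open>2 (n A / 2)^2 / (n b^2)\<close>.\<close>

lemma (in prob_space) lower_tail_bounded_sum:
  assumes indep: "indep_vars (\<lambda>_. borel) V {..<n}" and "0 < n" "0 < b" "0 < A"
    and V: "\<And>i x. i < n \<Longrightarrow> 0 \<le> V i x \<and> V i x \<le> b"
    and A: "\<And>i. i < n \<Longrightarrow> A \<le> expectation (V i)"
  shows "prob {x\<in>space M. (\<Sum>i<n. V i x) \<le> real n * A / 2} \<le> exp (- (real n * A\<^sup>2 / (2 * b\<^sup>2)))"
proof -
  interpret Hoeffding_ineq M "{..<n}" V "\<lambda>_. 0" "\<lambda>_. b" "\<Sum>i<n. expectation (V i)"
    using indep V by unfold_locales auto
  have rv [measurable]: "V i \<in> borel_measurable M" if "i < n" for i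
    using that by (intro random_variable) simp
  have "(\<Sum>i<n. A) \<le> (\<Sum>i<n. expectation (V i))"
    by (intro sum_mono A) auto
  then have "{x\<in>space M. (\<Sum>i<n. V i x) \<le> real n * A / 2}
      \<subseteq> {x\<in>space M. (\<Sum>i<n. V i x) \<le> (\<Sum>i<n. expectation (V i)) - real n * A / 2}"
    by auto
  then have "prob {x\<in>space M. (\<Sum>i<n. V i x) \<le> real n * A / 2}
      \<le> prob {x\<in>space M. (\<Sum>i<n. V i x) \<le> (\<Sum>i<n. expectation (V i)) - real n * A / 2}"
    by (rule finite_measure_mono) measurable
  also have "\<dots> \<le> exp (- 2 * (real n * A / 2)\<^sup>2 / (\<Sum>i<n. (b - 0)\<^sup>2))"
    using assms(2-4) by (intro Hoeffding_ineq_le) auto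
  also have "- 2 * (real n * A / 2)\<^sup>2 / (\<Sum>i<n. (b - 0)\<^sup>2) = - (real n * A\<^sup>2 / (2 * b\<^sup>2))"
    using assms(2-4) by (simp add: power2_eq_square field_simps)
  finally show ?thesis .
qed

text \<open>Markov's inequality for the number of events that occur.\<close>

lemma (in prob_space) prob_card_gt_le:
  assumes E [measurable]: "\<And>i. i < n \<Longrightarrow> E i \<in> events"
    and \<delta>: "\<And>i. i < n \<Longrightarrow> prob (E i) \<le> \<delta>"
  shows "{x\<in>space M. m < card {i. i < n \<and> x \<in> E i}} \<in> events"
    and "prob {x\<in>space M. m < card {i. i < n \<and> x \<in> E i}} \<le> real n * \<delta> / (real m + 1)"
proof -
  let ?f = "\<lambda>x. \<Sum>i<n. indicator (E i) x :: real"
  have int: "integrable M (\<lambda>x. indicator (E i) x :: real)" if "i < n" for i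
    using E[OF that] by (simp add: emeasure_eq_measure)
  have card: "real (card {i. i < n \<and> x \<in> E i}) = ?f x" for x
  proof -
    have "{..<n} \<inter> {i. x \<in> E i} = {i. i < n \<and> x \<in> E i}" by auto
    then show ?thesis
      by (simp add: indicator_def sum.If_cases)
  qed
  \<comment> \<open>For integers, exceeding \<open>m\<close> means reaching \<open>m + 1\<close>;
    the denominator comes from here.\<close>
  have eq: "{x\<in>space M. m < card {i. i < n \<and> x \<in> E i}} = {x\<in>space M. real m + 1 \<le> ?f x}"
    unfolding card[symmetric] by auto
  show "{x\<in>space M. m < card {i. i < n \<and> x \<in> E i}} \<in> events"
    unfolding eq by measurable
  have "prob {x\<in>space M. real m + 1 \<le> ?f x} \<le> expectation ?f / (real m + 1)"
    using int by (intro integral_Markov_inequality_measure[where A="{}"])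
      (auto intro!: Bochner_Integration.integrable_sum sum_nonneg)
  also have "expectation ?f = (\<Sum>i<n. prob (E i))"
    using int E by (simp add: Bochner_Integration.integral_sum)
  also have "\<dots> \<le> (\<Sum>i<n. \<delta>)" by (intro sum_mono \<delta>) auto
  finally show "prob {x\<in>space M. m < card {i. i < n \<and> x \<in> E i}} \<le> real n * \<delta> / (real m + 1)"
    unfolding eq by (simp add: divide_right_mono)
qed

section \<open>The independent walks\<close>

text \<open>Quantitative form of the infinite second moment: the right-hand side is of order
  \<open>c * w powr (\<alpha> - 2)\<close>, which is unbounded as \<open>w\<close> tends to
  0.\<close>

lemma ex_frequency:
  fixes c A \<alpha> :: real
  assumes "0 < \<alpha>" "\<alpha> < 2" "0 < c" "0 < A"
  obtains w where "0 < w" "A \<le> 2 / w\<^sup>2 * (1 - exp (- (c * w powr \<alpha>)))"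
proof
  \<comment> \<open>The first entry ensures \<open>c * w powr \<alpha> \<le> 1\<close>, the second
    \<open>A \<le> c * w powr \<alpha> / w^2\<close>.\<close>
  define w where "w = min ((1 / c) powr (1 / \<alpha>)) ((c / A) powr (1 / (2 - \<alpha>)))"
  show w: "0 < w" using assms by (simp add: w_def)
  have "w powr \<alpha> \<le> ((1 / c) powr (1 / \<alpha>)) powr \<alpha>"
    using assms w by (intro powr_mono2) (auto simp: w_def)
  then have y1: "c * w powr \<alpha> \<le> 1"
    using assms by (simp add: powr_powr field_simps)
  have "w powr (2 - \<alpha>) \<le> ((c / A) powr (1 / (2 - \<alpha>))) powr (2 - \<alpha>)"
    using assms w by (intro powr_mono2) (auto simp: w_def)
  then have "w powr (2 - \<alpha>) \<le> c / A"
    using assms by (simp add: powr_powr)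
  moreover have "w\<^sup>2 = w powr (2 - \<alpha>) * w powr \<alpha>"
    using w by (simp add: powr_add[symmetric])
  ultimately have "w\<^sup>2 \<le> c / A * w powr \<alpha>"
    by (simp only: mult_right_mono powr_ge_zero)
  then have A: "A \<le> c * w powr \<alpha> / w\<^sup>2"
    using w assms by (simp add: field_simps)
  define y where "y = c * w powr \<alpha>"
  have y: "0 \<le> y" "y \<le> 1" using assms y1 by (auto simp: y_def)
  \<comment> \<open>On the unit interval this chain gives \<open>y / 2 \<le> 1 - exp (- y)\<close>;
    the factor 2 in the claim absorbs the loss.\<close>
  have "exp (- y) \<le> 1 / (1 + y)"
    using exp_ge_add_one_self[of y] y by (simp add: exp_minus inverse_eq_divide frac_le)
  also have "\<dots> \<le> 1 - y / 2"
    using y by (simp add: field_simps mult_left_le)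
  finally have "y / w\<^sup>2 \<le> 2 / w\<^sup>2 * (1 - exp (- y))"
    using w by (simp add: field_simps)
  with A show "A \<le> 2 / w\<^sup>2 * (1 - exp (- (c * w powr \<alpha>)))"
    by (simp add: y_def)
qed

text \<open>The disjoint sum makes one independent family of the initial columns
  (\<open>Inl i\<close>) and the increments (\<open>Inr (i, k)\<close>). The stable law enters
  through the characteristic functions of its coordinates, which covers all three types at
  once.\<close>

locale stable_noise = prob_space M for M :: "'w measure" +
  fixes n :: nat and \<alpha> :: real and \<theta>0 :: "nat \<Rightarrow> 'w \<Rightarrow> real^'p" and X :: "nat \<Rightarrow> nat \<Rightarrow> 'w \<Rightarrow> real^'p"
    and \<mu>0 L1 :: "(real^'p) measure"
  assumes indep: "indep_vars (\<lambda>_. borel)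
        (\<lambda>j. case j of Inl i \<Rightarrow> \<theta>0 i | Inr (i, k) \<Rightarrow> X i k)
        (Inl ` {..<n} \<union> Inr ` ({..<n} \<times> UNIV))"
    and distr_\<theta>0: "\<And>i. i < n \<Longrightarrow> distr M borel (\<theta>0 i) = \<mu>0"
    and distr_X: "\<And>i k. i < n \<Longrightarrow> distr M borel (X i k) = L1"
    and \<alpha>_pos: "0 < \<alpha>"
    and L1_prob: "prob_space L1" and L1_sets: "sets L1 = sets borel"
    and L1_char: "\<And>c w. char (distr L1 borel (\<lambda>x. x $ c)) w = exp (- (\<bar>w\<bar> powr \<alpha>))"
    and \<mu>0_prob: "prob_space \<mu>0" and \<mu>0_sets: "sets \<mu>0 = sets borel"
begin

lemma rv_\<theta>0 [measurable]: "i < n \<Longrightarrow> \<theta>0 i \<in> borel_measurable M"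
  using indep unfolding indep_vars_def by (auto dest!: bspec[where x="Inl i"])

lemma rv_X [measurable]: "i < n \<Longrightarrow> X i k \<in> borel_measurable M"
  using indep unfolding indep_vars_def by (auto dest!: bspec[where x="Inr (i, k)"])

text \<open>The step scale \<open>s\<close> is absorbed here, so that a coordinate of the walk is a
  plain sum over an index set.\<close>

definition coord :: "'p \<Rightarrow> real \<Rightarrow> nat + nat \<times> nat \<Rightarrow> 'w \<Rightarrow> real" where
  "coord c s j \<omega> = (case j of Inl i \<Rightarrow> \<theta>0 i \<omega> $ c | Inr (i, k) \<Rightarrow> s * X i k \<omega> $ c)"

text \<open>All indices that column \<open>i\<close> uses in its first \<open>k\<close> steps.
  Distinct columns have disjoint blocks.\<close>

definition block :: "nat \<Rightarrow> nat \<Rightarrow> (nat + nat \<times> nat) set" where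
  "block k i = insert (Inl i) ((\<lambda>l. Inr (i, l)) ` {..<k})"

text \<open>The trajectory of one column with the gradient terms removed; \<open>s\<close> will be
  \<open>\<sigma> * \<eta> powr (1 / \<alpha>)\<close>.\<close>

definition walk :: "real \<Rightarrow> nat \<Rightarrow> nat \<Rightarrow> 'w \<Rightarrow> real^'p" where
  "walk s k i \<omega> = \<theta>0 i \<omega> + (\<Sum>l<k. s *\<^sub>R X i l \<omega>)"

lemma rv_walk [measurable]: "i < n \<Longrightarrow> walk s k i \<in> borel_measurable M"
  unfolding walk_def[abs_def] by measurable

lemma indep_coord:
  "indep_vars (\<lambda>_. borel) (coord c s) (Inl ` {..<n} \<union> Inr ` ({..<n} \<times> UNIV))"
proof -
  define Y where "Y j = (\<lambda>x::real^'p. case j of Inl (_::nat) \<Rightarrow> x $ c | Inr (_::nat \<times> nat) \<Rightarrow> s * x $ c)" for j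
  have "indep_vars (\<lambda>_. borel)
      (\<lambda>j \<omega>. Y j ((case j of Inl i \<Rightarrow> \<theta>0 i | Inr (i, k) \<Rightarrow> X i k) \<omega>))
      (Inl ` {..<n} \<union> Inr ` ({..<n} \<times> UNIV))"
    by (rule indep_vars_compose2[OF indep]) (auto simp: Y_def)
  moreover have "(\<lambda>j \<omega>. Y j ((case j of Inl i \<Rightarrow> \<theta>0 i | Inr (i, k) \<Rightarrow> X i k) \<omega>)) = coord c s"
    by (auto simp: fun_eq_iff Y_def coord_def split: sum.splits)
  ultimately show ?thesis by simp
qed

lemma block_subset: "i < n \<Longrightarrow> block k i \<subseteq> Inl ` {..<n} \<union> Inr ` ({..<n} \<times> UNIV)"
  by (auto simp: block_def)

lemma noise_nth: "(\<Sum>l<k. s *\<^sub>R X i l \<omega>) $ c = (\<Sum>j\<in>(\<lambda>l. Inr (i, l)) ` {..<k}. coord c s j \<omega>)"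
  by (subst sum.reindex) (auto simp: inj_on_def coord_def)

lemma walk_nth: "walk s k i \<omega> $ c = (\<Sum>j\<in>block k i. coord c s j \<omega>)"
proof -
  have "(\<Sum>j\<in>block k i. coord c s j \<omega>) =
      coord c s (Inl i) \<omega> + (\<Sum>j\<in>(\<lambda>l. Inr (i, l)) ` {..<k}. coord c s j \<omega>)"
    unfolding block_def by (rule sum.insert) auto
  moreover have "coord c s (Inl i) \<omega> = \<theta>0 i \<omega> $ c" by (simp add: coord_def)
  ultimately show ?thesis by (simp only: walk_def vector_add_component noise_nth)
qed

text \<open>Functions of disjoint blocks of an independent family are independent. The truncation at
  \<open>b\<close> provides the boundedness for Hoeffding's inequality.\<close>

lemma indep_walk_truncated:
  "indep_vars (\<lambda>_. borel) (\<lambda>i \<omega>. min ((walk s k i \<omega> $ c)\<^sup>2) b) {..<n}"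
proof -
  have "indep_vars (\<lambda>i. PiM (block k i) (\<lambda>_. borel)) (\<lambda>i \<omega>. restrict (\<lambda>j. coord c s j \<omega>) (block k i)) {..<n}"
    by (rule indep_vars_restrict[OF indep_coord block_subset])
       (auto simp: disjoint_family_on_def block_def)
  then have "indep_vars (\<lambda>_. borel)
      (\<lambda>i \<omega>. min ((\<Sum>j\<in>block k i. restrict (\<lambda>j. coord c s j \<omega>) (block k i) j)\<^sup>2) b) {..<n}"
    by (rule indep_vars_compose2[where Y="\<lambda>i x. min ((\<Sum>j\<in>block k i. x j)\<^sup>2) b"]) measurable
  then show ?thesis by (simp add: walk_nth)
qed

section \<open>Characteristic functions of the walks\<close>

lemma char_coord_noise:
  assumes "i < n" "0 < s"
  shows "char (distr M borel (coord c s (Inr (i, l)))) w = exp (- (s powr \<alpha> * \<bar>w\<bar> powr \<alpha>))"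
proof -
  have m: "X i l \<in> borel_measurable M" using assms by simp
  have "char (distr M borel (coord c s (Inr (i, l)))) w = char (distr M borel (\<lambda>\<omega>. X i l \<omega> $ c)) (s * w)"
    using char_distr_scale[of "\<lambda>\<omega>. X i l \<omega> $ c" M s w] m by (simp add: coord_def[abs_def])
  also have "distr M borel (\<lambda>\<omega>. X i l \<omega> $ c) = distr L1 borel (\<lambda>x. x $ c)"
    unfolding distr_X[OF assms(1), of l, symmetric] by (subst distr_distr[OF _ m]) (auto simp: comp_def)
  also have "char (distr L1 borel (\<lambda>x. x $ c)) (s * w) = exp (- (s powr \<alpha> * \<bar>w\<bar> powr \<alpha>))"
    using \<open>0 < s\<close> by (simp add: L1_char abs_mult powr_mult)
  finally show ?thesis .
qed

text \<open>The \<open>k\<close> independent factors multiply, so the exponents add. For the scale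
  of the update, \<open>k * s powr \<alpha>\<close> is \<open>\<sigma> powr \<alpha>\<close> times
  the elapsed time \<open>k * \<eta>\<close>.\<close>

lemma char_noise:
  assumes "i < n" "0 < s"
  shows "char (distr M borel (\<lambda>\<omega>. (\<Sum>l<k. s *\<^sub>R X i l \<omega>) $ c)) w
    = exp (- (real k * s powr \<alpha> * \<bar>w\<bar> powr \<alpha>))"
proof -
  have "char (distr M borel (\<lambda>\<omega>. (\<Sum>l<k. s *\<^sub>R X i l \<omega>) $ c)) w =
      (\<Prod>j\<in>(\<lambda>l. Inr (i, l)) ` {..<k}. char (distr M borel (coord c s j)) w)"
    unfolding noise_nth
    using block_subset[OF \<open>i < n\<close>, of k]
    by (intro char_distr_sum indep_vars_subset[OF indep_coord]) (auto simp: block_def)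
  also have "\<dots> = (\<Prod>l<k. complex_of_real (exp (- (s powr \<alpha> * \<bar>w\<bar> powr \<alpha>))))"
    using assms by (subst prod.reindex) (auto simp: inj_on_def char_coord_noise)
  also have "\<dots> = complex_of_real (exp (- (s powr \<alpha> * \<bar>w\<bar> powr \<alpha>)) ^ k)" by simp
  also have "exp (- (s powr \<alpha> * \<bar>w\<bar> powr \<alpha>)) ^ k = exp (- (real k * s powr \<alpha> * \<bar>w\<bar> powr \<alpha>))"
    by (simp add: exp_of_nat_mult[symmetric] mult.assoc)
  finally show ?thesis .
qed

text \<open>The independent initial value contributes a factor of modulus at most 1, so it cannot
  destroy the decay coming from the noise.\<close>

lemma cmod_char_walk_le:
  assumes "i < n" "0 < s"
  shows "cmod (char (distr M borel (\<lambda>\<omega>. walk s k i \<omega> $ c)) w) \<le> exp (- (real k * s powr \<alpha> * \<bar>w\<bar> powr \<alpha>))"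
proof -
  let ?J = "(\<lambda>l. Inr (i, l)) ` {..<k}"
  have "Inl i \<in> block k i" by (simp add: block_def)
  then have m: "coord c s (Inl i) \<in> borel_measurable M"
    using indep_coord[of c s] block_subset[OF \<open>i < n\<close>, of k] unfolding indep_vars_def by blast
  have "char (distr M borel (\<lambda>\<omega>. walk s k i \<omega> $ c)) w = (\<Prod>j\<in>block k i. char (distr M borel (coord c s j)) w)"
    unfolding walk_nth
    using block_subset[OF \<open>i < n\<close>, of k]
    by (intro char_distr_sum indep_vars_subset[OF indep_coord])
  also have "\<dots> = char (distr M borel (coord c s (Inl i))) w * (\<Prod>j\<in>?J. char (distr M borel (coord c s j)) w)"
    unfolding block_def by (subst prod.insert) auto
  also have "(\<Prod>j\<in>?J. char (distr M borel (coord c s j)) w) = char (distr M borel (\<lambda>\<omega>. (\<Sum>l<k. s *\<^sub>R X i l \<omega>) $ c)) w"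
    unfolding noise_nth
    using block_subset[OF \<open>i < n\<close>, of k]
    by (intro char_distr_sum[symmetric] indep_vars_subset[OF indep_coord]) (auto simp: block_def)
  finally have "cmod (char (distr M borel (\<lambda>\<omega>. walk s k i \<omega> $ c)) w) =
      cmod (char (distr M borel (coord c s (Inl i))) w) * exp (- (real k * s powr \<alpha> * \<bar>w\<bar> powr \<alpha>))"
    by (simp only: norm_mult char_noise[OF assms] norm_of_real abs_exp_cancel)
  also have "\<dots> \<le> 1 * exp (- (real k * s powr \<alpha> * \<bar>w\<bar> powr \<alpha>))"
    by (intro mult_right_mono real_distribution.cmod_char_le_1 real_distribution_distr m) simp
  finally show ?thesis by simp
qed

text \<open>The norm of the noise is at most the sum of its absolute coordinates, so a walk beyond
  the threshold has its initial value beyond \<open>q0\<close> or some noise coordinate beyond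
  \<open>q * d powr (1 / \<alpha>)\<close>. The union bound runs over \<open>1 + CARD('p)\<close>
  events.\<close>

lemma walk_tail_le:
  assumes "i < n" "0 < s" "0 < k" and d: "real k * s powr \<alpha> \<le> d"
    and q0: "measure \<mu>0 {x. q0 < norm x} \<le> \<delta>"
    and q: "0 < q" "measure L1 {x. q < norm x} \<le> \<delta>"
  shows "prob {\<omega>\<in>space M. q0 + real CARD('p) * (q * d powr (1 / \<alpha>)) < norm (walk s k i \<omega>)}
    \<le> (1 + real CARD('p)) * \<delta>"
proof -
  note [measurable] = rv_\<theta>0[OF \<open>i < n\<close>] rv_X[OF \<open>i < n\<close>] rv_walk[OF \<open>i < n\<close>]
  let ?S = "\<lambda>\<omega>. \<Sum>l<k. s *\<^sub>R X i l \<omega>" and ?r = "q * d powr (1 / \<alpha>)"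
  let ?I = "{\<omega>\<in>space M. q0 < norm (\<theta>0 i \<omega>)}" and ?E = "\<lambda>c. {\<omega>\<in>space M. ?r < \<bar>?S \<omega> $ c\<bar>}"
  have "prob ?I \<le> \<delta>"
  proof -
    have "prob ?I = measure (distr M borel (\<theta>0 i)) {x. q0 < norm x}"
      by (subst measure_distr) (auto intro!: arg_cong[where f=prob])
    then show ?thesis using q0 distr_\<theta>0[OF \<open>i < n\<close>] by simp
  qed
  have E: "prob (?E c) \<le> \<delta>" for c
  proof -
    interpret L: prob_space L1 by (rule L1_prob)
    have [measurable_cong]: "sets L1 = sets borel" by (rule L1_sets)
    have sp: "space L1 = UNIV" using sets_eq_imp_space_eq[OF L1_sets] by simp
    have Z: "real_distribution (distr L1 borel (\<lambda>x. x $ c))"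
      by (rule L.real_distribution_distr) measurable
    have "prob (?E c) \<le> measure (distr L1 borel (\<lambda>x. x $ c)) {z. q < \<bar>z\<bar>}"
    proof (rule stable_tail_le[OF _ _ Z L1_char])
      show "char (distr M borel (\<lambda>\<omega>. ?S \<omega> $ c)) w = exp (- ((real k * s powr \<alpha>) * \<bar>w\<bar> powr \<alpha>))" for w
        using char_noise[OF assms(1,2)] by simp
      show "0 < real k * s powr \<alpha>" using assms by simp
      show "(\<lambda>\<omega>. ?S \<omega> $ c) \<in> borel_measurable M" by measurable (rule assms)
    qed (use \<alpha>_pos d q in simp_all)
    also have "\<dots> = measure L1 {x. q < \<bar>x $ c\<bar>}"
      by (subst measure_distr) (auto simp: sp vimage_def)
    \<comment> \<open>Bounding a coordinate by the norm lets a single \<open>q\<close> serve all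
      coordinates.\<close>
    also have "\<dots> \<le> measure L1 {x. q < norm x}"
      by (rule L.finite_measure_mono) (auto intro: order_less_le_trans component_le_norm_cart)
    also have "\<dots> \<le> \<delta>" by (rule q)
    finally show ?thesis .
  qed
  have sub: "{\<omega>\<in>space M. q0 + real CARD('p) * ?r < norm (walk s k i \<omega>)} \<subseteq> ?I \<union> (\<Union>c. ?E c)"
  proof
    fix \<omega> assume \<omega>: "\<omega> \<in> {\<omega>\<in>space M. q0 + real CARD('p) * ?r < norm (walk s k i \<omega>)}"
    show "\<omega> \<in> ?I \<union> (\<Union>c. ?E c)"
    proof (rule ccontr)
      assume "\<omega> \<notin> ?I \<union> (\<Union>c. ?E c)"
      then have "norm (\<theta>0 i \<omega>) \<le> q0" and S: "\<And>c. \<bar>?S \<omega> $ c\<bar> \<le> ?r"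
        using \<omega> by (auto simp: not_less)
      have "norm (?S \<omega>) \<le> (\<Sum>c\<in>UNIV. \<bar>?S \<omega> $ c\<bar>)" by (rule norm_le_l1_cart)
      also have "\<dots> \<le> (\<Sum>c\<in>(UNIV :: 'p set). ?r)" by (intro sum_mono S)
      finally have "norm (?S \<omega>) \<le> real CARD('p) * ?r" by simp
      with \<open>norm (\<theta>0 i \<omega>) \<le> q0\<close> have "norm (walk s k i \<omega>) \<le> q0 + real CARD('p) * ?r"
        unfolding walk_def using norm_triangle_ineq[of "\<theta>0 i \<omega>" "?S \<omega>"] by linarith
      with \<omega> show False by simp
    qed
  qed
  have "prob {\<omega>\<in>space M. q0 + real CARD('p) * ?r < norm (walk s k i \<omega>)} \<le> prob (?I \<union> (\<Union>c. ?E c))"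
    by (rule finite_measure_mono[OF sub]) measurable
  also have "\<dots> \<le> prob ?I + prob (\<Union>c. ?E c)"
    by (rule measure_Un_le) measurable
  also have "prob (\<Union>c. ?E c) \<le> (\<Sum>c\<in>UNIV. prob (?E c))"
    by (rule finite_measure_subadditive_finite) (auto simp: image_subset_iff)
  also have "\<dots> \<le> (\<Sum>c\<in>(UNIV :: 'p set). \<delta>)" by (intro sum_mono E)
  finally show ?thesis using \<open>prob ?I \<le> \<delta>\<close> by (simp add: algebra_simps)
qed

text \<open>The truncation level \<open>4 / w^2\<close> is the one attached to the frequency
  \<open>w\<close> in \<open>expectation_min_square_ge\<close>. The lower bound \<open>c0\<close>
  gives every truncated square a mean of at least \<open>A\<close>, and Hoeffding's inequality
  applies.\<close>

lemma walk_energy_lower_tail: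
  assumes "0 < n" "0 < s" and c0: "c0 \<le> real k * s powr \<alpha>"
    and w: "0 < w" "0 < A" "A \<le> 2 / w\<^sup>2 * (1 - exp (- (c0 * w powr \<alpha>)))"
  shows "prob {\<omega>\<in>space M. (\<Sum>i<n. min ((walk s k i \<omega> $ c)\<^sup>2) (4 / w\<^sup>2)) \<le> real n * A / 2}
    \<le> exp (- (real n * A\<^sup>2 / (2 * (4 / w\<^sup>2)\<^sup>2)))"
proof (rule lower_tail_bounded_sum[OF indep_walk_truncated \<open>0 < n\<close> _ \<open>0 < A\<close>])
  fix i assume i: "i < n"
  have m: "(\<lambda>\<omega>. walk s k i \<omega> $ c) \<in> borel_measurable M"
    by (rule measurable_compose[OF rv_walk[OF i] borel_measurable_vec_nth])
  have "exp (- (real k * s powr \<alpha> * \<bar>w\<bar> powr \<alpha>)) \<le> exp (- (c0 * w powr \<alpha>))"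
    using c0 w by (simp add: mult_right_mono)
  with cmod_char_walk_le[OF i \<open>0 < s\<close>, of k c w]
  have "cmod (char (distr M borel (\<lambda>\<omega>. walk s k i \<omega> $ c)) w) \<le> exp (- (c0 * w powr \<alpha>))" by linarith
  then have "2 / w\<^sup>2 * (1 - exp (- (c0 * w powr \<alpha>)))
      \<le> 2 / w\<^sup>2 * (1 - cmod (char (distr M borel (\<lambda>\<omega>. walk s k i \<omega> $ c)) w))"
    by (intro mult_left_mono) auto
  also have "\<dots> \<le> expectation (\<lambda>\<omega>. min ((walk s k i \<omega> $ c)\<^sup>2) (4 / w\<^sup>2))"
    by (rule expectation_min_square_ge[OF m w(1)])
  finally show "A \<le> expectation (\<lambda>\<omega>. min ((walk s k i \<omega> $ c)\<^sup>2) (4 / w\<^sup>2))"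
    using w by linarith
qed (use w in auto)

end

section \<open>Compressibility\<close>

theorem theorem1:
  fixes \<pi> :: "('x \<times> 'y) measure"
    and h :: "'x \<Rightarrow> real^'p \<Rightarrow> real^'l"
    and Dh :: "'x \<Rightarrow> real^'p \<Rightarrow> ((real^'p) \<Rightarrow>\<^sub>L (real^'l))"
    and D2h :: "'x \<Rightarrow> real^'p \<Rightarrow> ((real^'p) \<Rightarrow>\<^sub>L ((real^'p) \<Rightarrow>\<^sub>L (real^'l)))"
    and loss :: "real^'l \<Rightarrow> 'y \<Rightarrow> real"
    and Dl :: "'y \<Rightarrow> real^'l \<Rightarrow> ((real^'l) \<Rightarrow>\<^sub>L real)"
    and D2l :: "'y \<Rightarrow> real^'l \<Rightarrow> ((real^'l) \<Rightarrow>\<^sub>L ((real^'l) \<Rightarrow>\<^sub>L real))"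
    and \<Psi> :: "'x \<Rightarrow> real" and \<Phi> :: "'y \<Rightarrow> real" and B :: real
    and \<alpha> \<sigma> :: real
    and \<mu>0 :: "(real^'p) measure"
    and L1 :: "(real^'p) measure"
  assumes alpha: "1 < \<alpha>" "\<alpha> < 2"
    and sigma: "0 < \<sigma>"
    \<comment> \<open>data distribution\<close>
    and pi_prob: "prob_space \<pi>"
    \<comment> \<open>standing assumption on the models h_x\<close>
    and h_D1: "\<And>x \<theta>. (h x has_derivative blinfun_apply (Dh x \<theta>)) (at \<theta>)"
    and h_D2: "\<And>x \<theta>. (Dh x has_derivative blinfun_apply (D2h x \<theta>)) (at \<theta>)"
    and h_bound: "\<And>x. \<exists>a b c. a + b + c \<le> \<Psi> x \<and>
        (\<forall>\<theta>. norm (h x \<theta>) \<le> a \<and> norm (Dh x \<theta>) \<le> b \<and> norm (D2h x \<theta>) \<le> c)"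
    \<comment> \<open>standing assumption on the loss (derivatives in the first argument)\<close>
    and loss_nonneg: "\<And>z y. 0 \<le> loss z y"
    and l_D1: "\<And>y z. ((\<lambda>w. loss w y) has_derivative blinfun_apply (Dl y z)) (at z)"
    and l_D2: "\<And>y z. (Dl y has_derivative blinfun_apply (D2l y z)) (at z)"
    and l_bound: "\<And>y. \<exists>a b. a + b \<le> \<Phi> y \<and> (\<forall>z. norm (Dl y z) \<le> a \<and> norm (D2l y z) \<le> b)"
    \<comment> \<open>moment condition\<close>
    and B_pos: "0 < B"
    and moment_int: "integrable \<pi> (\<lambda>xy. (\<Psi> (fst xy))\<^sup>2 * (1 + (\<Phi> (snd xy))\<^sup>2))"
    and moment_bound: "(\<integral>xy. (\<Psi> (fst xy))\<^sup>2 * (1 + (\<Phi> (snd xy))\<^sup>2) \<partial>\<pi>) \<le> B\<^sup>2"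
    \<comment> \<open>measurability of the data-dependence and finiteness of the risk\<close>
    and h_meas: "\<And>\<theta>. (\<lambda>xy. h (fst xy) \<theta>) \<in> borel_measurable \<pi>"
    and l_meas: "\<And>z. (\<lambda>xy. loss z (snd xy)) \<in> borel_measurable \<pi>"
    and risk_finite: "\<And>n W. integrable \<pi> (\<lambda>xy. loss (mf_net h n W (fst xy)) (snd xy))"
    \<comment> \<open>initial law\<close>
    and mu0_prob: "prob_space \<mu>0" and mu0_sets: "sets \<mu>0 = sets borel"
    and mu0_moment: "integrable \<mu>0 norm"
    \<comment> \<open>law of L_1 for an alpha-stable Levy process of Type I, II or III\<close>
    and L1_type: "stable_typeI \<alpha> L1 \<or> stable_typeII \<alpha> L1 \<or> stable_typeIII \<alpha> L1"
  shows "\<forall>t>0. \<forall>\<kappa>. 0 < \<kappa> \<and> \<kappa> < 1 \<longrightarrow>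
    (\<exists>\<epsilon>0>0. \<forall>\<epsilon>. 0 < \<epsilon> \<and> \<epsilon> < \<epsilon>0 \<longrightarrow>
      (\<exists>N::nat. \<forall>n\<ge>N. \<forall>\<eta>. 0 < \<eta> \<and> \<eta> \<le> real n powr (- \<alpha> / 2 - 1) \<longrightarrow>
        (\<forall>(M::'\<omega> measure) (\<theta>0 :: nat \<Rightarrow> '\<omega> \<Rightarrow> real^'p) (X :: nat \<Rightarrow> nat \<Rightarrow> '\<omega> \<Rightarrow> real^'p).
           prob_space M
           \<and> prob_space.indep_vars M (\<lambda>_. borel)
               (\<lambda>j. case j of Inl i \<Rightarrow> \<theta>0 i | Inr (i, k) \<Rightarrow> X i k)
               (Inl ` {..<n} \<union> Inr ` ({..<n} \<times> UNIV))
           \<and> (\<forall>i<n. distr M borel (\<theta>0 i) = \<mu>0)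
           \<and> (\<forall>i<n. \<forall>k. distr M borel (X i k) = L1)
           \<longrightarrow>
           measure M {\<omega> \<in> space M.
              (let W = sgd_traj \<pi> h loss \<alpha> \<sigma> n \<eta> (\<lambda>i. \<theta>0 i \<omega>) (\<lambda>k i. X i k \<omega>) (nat \<lfloor>t / \<eta>\<rfloor>)
               in frob n (\<lambda>i. trunc_top n (nat \<lfloor>\<kappa> * real n\<rfloor>) W i - W i) / frob n W \<le> \<epsilon>)}
             \<ge> 1 - \<epsilon>)))"
proof (intro allI impI, rule exI[of _ 1], rule conjI, simp, intro allI impI)
  \<comment> \<open>The threshold below which \<epsilon> has to lie is taken to be 1.\<close>
  fix t \<kappa> \<epsilon> :: real
  assume t: "0 < t" and \<kappa>: "0 < \<kappa> \<and> \<kappa> < 1" and \<epsilon>: "0 < \<epsilon> \<and> \<epsilon> < 1"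
  have \<Psi>\<Phi>: "norm (Dh x \<theta>) \<le> \<Psi> x" "norm (Dl y z) \<le> \<Phi> y" for x \<theta> y z
  proof -
    obtain a b c where abc: "a + b + c \<le> \<Psi> x"
      "\<And>\<theta>. norm (h x \<theta>) \<le> a \<and> norm (Dh x \<theta>) \<le> b \<and> norm (D2h x \<theta>) \<le> c"
      using h_bound[of x] by blast
    then show "norm (Dh x \<theta>) \<le> \<Psi> x"
      using abc(2)[of \<theta>] norm_ge_zero[of "h x \<theta>"] norm_ge_zero[of "D2h x \<theta>"] by linarith
    obtain a' b' where ab: "a' + b' \<le> \<Phi> y" "\<And>z. norm (Dl y z) \<le> a' \<and> norm (D2l y z) \<le> b'"
      using l_bound[of y] by blast
    then show "norm (Dl y z) \<le> \<Phi> y"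
      using ab(2)[of z] norm_ge_zero[of "D2l y z"] by linarith
  qed
  interpret R: mean_field_risk \<pi> h Dh loss Dl \<Psi> \<Phi> B
    by (rule mean_field_risk.intro) (fact pi_prob h_D1 \<Psi>\<Phi> l_D1 moment_int moment_bound risk_finite)+
  note L1 = stable_type_coordinate[OF L1_type]

  \<comment> \<open>Constants uniform in the number of columns and the step size\<close>
  define p where "p = real CARD('p)"
  have p: "0 \<le> p" by (simp add: p_def)
  \<comment> \<open>Dividing by \<open>1 + p\<close> offsets the union bound in
    \<open>walk_tail_le\<close>; the factor \<open>\<kappa>\<close> offsets Markov's inequality with
    about \<open>\<kappa> * n\<close> admissible exceedances, which leaves
    \<open>\<epsilon> / 2\<close>.\<close>
  define \<delta> where "\<delta> = \<epsilon> * \<kappa> / (2 * (1 + p))"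
  have "1 + p \<noteq> 0" using p by simp
  then have \<delta>: "0 < \<delta>" "(1 + p) * \<delta> = \<epsilon> * \<kappa> / 2"
    using \<epsilon> \<kappa> p unfolding \<delta>_def by (simp_all only: times_divide_eq_right) (auto simp: field_simps)
  interpret \<mu>0: prob_space \<mu>0 by (rule mu0_prob)
  interpret L1: prob_space L1 by (rule L1(1))
  have [measurable_cong]: "sets \<mu>0 = sets borel" "sets L1 = sets borel"
    using mu0_sets L1(2) by auto
  have space: "space \<mu>0 = UNIV" "space L1 = UNIV"
    using sets_eq_imp_space_eq[OF mu0_sets] sets_eq_imp_space_eq[OF L1(2)] by auto
  have "norm \<in> borel_measurable \<mu>0" "norm \<in> borel_measurable L1" by measurable
  note tails = \<mu>0.prob_abs_gt_small[OF this(1) \<delta>(1)] L1.prob_abs_gt_small[OF this(2) \<delta>(1)]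
  obtain q0 where "0 < q0" "measure \<mu>0 {x\<in>space \<mu>0. q0 < \<bar>norm x\<bar>} < \<delta>" by (rule tails(1))
  then have q0: "0 < q0" "measure \<mu>0 {x. q0 < norm x} \<le> \<delta>" by (simp_all add: space)
  obtain qL where "0 < qL" "measure L1 {x\<in>space L1. qL < \<bar>norm x\<bar>} < \<delta>" by (rule tails(2))
  then have qL: "0 < qL" "measure L1 {x. qL < norm x} \<le> \<delta>" by (simp_all add: space)
  \<comment> \<open>\<open>d\<close> is the stable parameter of the noise accumulated by time
    \<open>t\<close>. \<open>Q\<close> is a level for the walks, \<open>D\<close> bounds the total
    drift, and \<open>q\<close> is the resulting level for the columns. \<open>A\<close> solves
    \<open>A / 4 - D^2 = (q / \<epsilon>)^2\<close>.\<close>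
  define d where "d = t * \<sigma> powr \<alpha>"
  define Q where "Q = q0 + p * (qL * d powr (1 / \<alpha>))"
  define D where "D = R.C * t"
  define q where "q = Q + D"
  define A where "A = 4 * (D\<^sup>2 + (q / \<epsilon>)\<^sup>2)"
  have d: "0 < d" using t sigma by (simp add: d_def)
  have "0 < Q" using q0 qL p by (simp add: Q_def add_pos_nonneg)
  moreover have "0 < D" using R.C_pos t by (simp add: D_def)
  ultimately have q: "0 < q" by (simp add: q_def)
  then have A: "0 < A" using \<epsilon> by (simp add: A_def add_nonneg_pos)
  \<comment> \<open>\<open>d / 2\<close> appears because rounding down the number of steps keeps at
    least half of the time.\<close>
  obtain w where w: "0 < w" "A \<le> 2 / w\<^sup>2 * (1 - exp (- (d / 2 * w powr \<alpha>)))"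
    by (rule ex_frequency[of \<alpha> "d / 2" A]) (use alpha d A in auto)
  define r where "r = A\<^sup>2 / (2 * (4 / w\<^sup>2)\<^sup>2)"
  have r: "0 < r" using A w by (simp add: r_def)
  \<comment> \<open>\<open>N1\<close> pushes the Hoeffding bound below
    \<open>\<epsilon> / 2\<close>; \<open>N2\<close> forces
    \<open>\<eta> \<le> t / 2\<close>.\<close>
  obtain N1 where N1: "ln (2 / \<epsilon>) < real N1 * r"
    using ex_less_of_nat_mult[OF r] by blast
  obtain N2 where N2: "2 / t \<le> real N2" using real_arch_simple by blast
  show "\<exists>N::nat. \<forall>n\<ge>N. \<forall>\<eta>. 0 < \<eta> \<and> \<eta> \<le> real n powr (- \<alpha> / 2 - 1) \<longrightarrow>
      (\<forall>(M::'\<omega> measure) (\<theta>0 :: nat \<Rightarrow> '\<omega> \<Rightarrow> real^'p) (X :: nat \<Rightarrow> nat \<Rightarrow> '\<omega> \<Rightarrow> real^'p).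
         prob_space M
         \<and> prob_space.indep_vars M (\<lambda>_. borel)
             (\<lambda>j. case j of Inl i \<Rightarrow> \<theta>0 i | Inr (i, k) \<Rightarrow> X i k)
             (Inl ` {..<n} \<union> Inr ` ({..<n} \<times> UNIV))
         \<and> (\<forall>i<n. distr M borel (\<theta>0 i) = \<mu>0)
         \<and> (\<forall>i<n. \<forall>k. distr M borel (X i k) = L1)
         \<longrightarrow>
         measure M {\<omega> \<in> space M.
            (let W = sgd_traj \<pi> h loss \<alpha> \<sigma> n \<eta> (\<lambda>i. \<theta>0 i \<omega>) (\<lambda>k i. X i k \<omega>) (nat \<lfloor>t / \<eta>\<rfloor>)
             in frob n (\<lambda>i. trunc_top n (nat \<lfloor>\<kappa> * real n\<rfloor>) W i - W i) / frob n W \<le> \<epsilon>)}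
           \<ge> 1 - \<epsilon>)"
  proof (intro exI[of _ "max (max N1 N2) 1"] allI impI)
    fix n :: nat and \<eta> :: real and M :: "'\<omega> measure"
      and \<theta>0 :: "nat \<Rightarrow> '\<omega> \<Rightarrow> real^'p" and X :: "nat \<Rightarrow> nat \<Rightarrow> '\<omega> \<Rightarrow> real^'p"
    assume "max (max N1 N2) 1 \<le> n" and \<eta>: "0 < \<eta> \<and> \<eta> \<le> real n powr (- \<alpha> / 2 - 1)"
      and M: "prob_space M
         \<and> prob_space.indep_vars M (\<lambda>_. borel)
             (\<lambda>j. case j of Inl i \<Rightarrow> \<theta>0 i | Inr (i, k) \<Rightarrow> X i k)
             (Inl ` {..<n} \<union> Inr ` ({..<n} \<times> UNIV))
         \<and> (\<forall>i<n. distr M borel (\<theta>0 i) = \<mu>0)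
         \<and> (\<forall>i<n. \<forall>k. distr M borel (X i k) = L1)"
    then have n: "N1 \<le> n" "N2 \<le> n" "1 \<le> n" by auto
    interpret M: prob_space M using M by blast
    interpret S: stable_noise M n \<alpha> \<theta>0 X \<mu>0 L1
      using M alpha mu0_prob mu0_sets L1 by (intro stable_noise.intro stable_noise_axioms.intro) auto

    \<comment> \<open>Elapsed time and accumulated scale\<close>
    define k where "k = nat \<lfloor>t / \<eta>\<rfloor>"
    define m where "m = nat \<lfloor>\<kappa> * real n\<rfloor>"
    define s where "s = \<sigma> * \<eta> powr (1 / \<alpha>)"
    \<comment> \<open>The exponent lies below -1 and \<open>1 \<le> n\<close>.\<close>
    have "\<eta> \<le> real n powr - 1"
      using \<eta> n alpha by (elim conjE order_trans) (intro powr_mono, auto)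
    also have "\<dots> = 1 / real n" using n by (simp add: powr_minus_divide)
    also have "\<dots> \<le> 1 / (2 / t)" using t N2 n by (intro divide_left_mono) auto
    finally have \<eta>_le: "\<eta> \<le> t / 2" by simp
    have "real k \<le> t / \<eta>" "t / \<eta> - 1 \<le> real k"
      using t \<eta> unfolding k_def by auto
    then have k: "real k * \<eta> \<le> t" "t / 2 \<le> real k * \<eta>"
      using \<eta> \<eta>_le by (auto simp: field_simps)
    then have "0 < k" using t by (intro gr0I) auto
    have m: "m \<le> n" "\<kappa> * real n \<le> real m + 1"
    proof -
      have "\<kappa> * real n \<le> real n" using \<kappa> by (simp add: mult_left_le_one_le)
      then show "m \<le> n" unfolding m_def by linarith
      show "\<kappa> * real n \<le> real m + 1" unfolding m_def using \<kappa> by linarith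
    qed
    have s: "0 < s" using sigma \<eta> by (simp add: s_def)
    \<comment> \<open>Self-similarity: the scale \<open>\<eta> powr (1 / \<alpha>)\<close> makes the
      parameter proportional to \<open>k * \<eta>\<close>, which lies between \<open>t / 2\<close>
      and \<open>t\<close>.\<close>
    have "real k * s powr \<alpha> = \<sigma> powr \<alpha> * (real k * \<eta>)"
      using sigma \<eta> alpha by (simp add: s_def powr_mult powr_powr)
    then have ks: "real k * s powr \<alpha> \<le> d" "d / 2 \<le> real k * s powr \<alpha>"
      using k mult_left_mono[of "real k * \<eta>" t "\<sigma> powr \<alpha>"] mult_left_mono[of "t / 2" "real k * \<eta>" "\<sigma> powr \<alpha>"]
      by (auto simp: d_def mult_ac)

    \<comment> \<open>Exceptional events for the independent walks\<close>
    define E where "E i = {\<omega>\<in>space M. Q < norm (S.walk s k i \<omega>)}" for i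
    have E: "E i \<in> sets M" "measure M (E i) \<le> \<epsilon> * \<kappa> / 2" if "i < n" for i
    proof -
      have [measurable]: "S.walk s k i \<in> borel_measurable M" using that by (rule S.rv_walk)
      show "E i \<in> sets M" unfolding E_def by measurable
      show "measure M (E i) \<le> \<epsilon> * \<kappa> / 2"
        unfolding E_def Q_def using S.walk_tail_le[OF that s \<open>0 < k\<close> ks(1) q0(2) qL] \<delta>(2)
        by (simp add: p_def)
    qed
    define bad1 where "bad1 = {\<omega>\<in>space M. m < card {i. i < n \<and> \<omega> \<in> E i}}"
    have bad1: "bad1 \<in> sets M" "measure M bad1 \<le> \<epsilon> / 2"
    proof -
      show "bad1 \<in> sets M" unfolding bad1_def by (rule M.prob_card_gt_le[OF E])
      have "measure M bad1 \<le> real n * (\<epsilon> * \<kappa> / 2) / (real m + 1)"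
        unfolding bad1_def by (rule M.prob_card_gt_le[OF E])
      \<comment> \<open>The 1 in the denominator compensates the rounding:
        \<open>\<kappa> * n \<le> m + 1\<close>.\<close>
      also have "\<dots> \<le> \<epsilon> / 2"
        using mult_left_mono[OF m(2), of "\<epsilon> / 2"] \<epsilon> by (simp add: divide_le_eq algebra_simps)
      finally show "measure M bad1 \<le> \<epsilon> / 2" .
    qed
    \<comment> \<open>Any coordinate will do, since each alone carries enough energy; the index type
      is non-empty.\<close>
    obtain c :: 'p where True by blast
    define bad2 where "bad2 = {\<omega>\<in>space M.
      (\<Sum>i<n. min ((S.walk s k i \<omega> $ c)\<^sup>2) (4 / w\<^sup>2)) \<le> real n * A / 2}"
    have bad2: "bad2 \<in> sets M" "measure M bad2 \<le> \<epsilon> / 2"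
    proof -
      have [measurable]: "(\<lambda>\<omega>. S.walk s k i \<omega> $ c) \<in> borel_measurable M" if "i < n" for i
        by (rule measurable_compose[OF S.rv_walk[OF that] borel_measurable_vec_nth])
      show "bad2 \<in> sets M" unfolding bad2_def by measurable
      have "measure M bad2 \<le> exp (- (real n * A\<^sup>2 / (2 * (4 / w\<^sup>2)\<^sup>2)))"
        unfolding bad2_def using n by (intro S.walk_energy_lower_tail[OF _ s ks(2) w(1) A w(2)]) simp
      also have "\<dots> = exp (- (real n * r))" by (simp add: r_def)
      also have "\<dots> \<le> exp (- ln (2 / \<epsilon>))"
      proof -
        have "real N1 * r \<le> real n * r" using n r by (intro mult_right_mono) auto
        with N1 show ?thesis by simp
      qed
      also have "\<dots> = \<epsilon> / 2" using \<epsilon> by (simp add: exp_minus)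
      finally show "measure M bad2 \<le> \<epsilon> / 2" .
    qed

    \<comment> \<open>Transfer to the trajectory\<close>
    define W where "W \<omega> = sgd_traj \<pi> h loss \<alpha> \<sigma> n \<eta> (\<lambda>i. \<theta>0 i \<omega>) (\<lambda>k i. X i k \<omega>) k" for \<omega>
    define T where "T = {\<omega>\<in>space M. frob n (\<lambda>i. trunc_top n m (W \<omega>) i - W \<omega> i) / frob n (W \<omega>) \<le> \<epsilon>}"
    have W_meas [measurable]: "(\<lambda>\<omega>. W \<omega> i) \<in> borel_measurable M" if "i < n" for i
      unfolding W_def using that by (intro R.measurable_sgd_traj) auto
    have [measurable]: "(\<lambda>\<omega>. frob n (W \<omega>)) \<in> borel_measurable M"
      unfolding frob_def by measurable
    have [measurable]: "(\<lambda>\<omega>. frob n (\<lambda>i. trunc_top n m (W \<omega>) i - W \<omega> i)) \<in> borel_measurable M"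
      by (rule measurable_frob_trunc_top[OF m(1) W_meas])
    \<comment> \<open>The final monotonicity step rests on this: \<open>measure\<close> is 0 on
      non-measurable sets, so an inclusion alone gives no lower bound.\<close>
    have T: "T \<in> sets M" unfolding T_def by measurable
    have W_close: "norm (W \<omega> i - S.walk s k i \<omega>) \<le> D" if "i < n" for \<omega> i
    proof -
      have "norm (W \<omega> i - S.walk s k i \<omega>) \<le> R.C * (real k * \<eta>)"
        unfolding W_def S.walk_def s_def using \<eta> that by (intro R.sgd_traj_drift_le) auto
      also have "\<dots> \<le> D"
        unfolding D_def using k R.C_pos by (intro mult_left_mono) auto
      finally show ?thesis .
    qed
    \<comment> \<open>Outside both events, a column beyond \<open>q = Q + D\<close> comes from a
      walk beyond \<open>Q\<close>, so at most \<open>m\<close> columns exceed \<open>q\<close>,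
      while the squared norm is at least \<open>n * (q / \<epsilon>)^2\<close>.\<close>
    have "space M - (bad1 \<union> bad2) \<subseteq> T"
    proof
      fix \<omega> assume \<omega>: "\<omega> \<in> space M - (bad1 \<union> bad2)"
      have "{i. i < n \<and> q < norm (W \<omega> i)} \<subseteq> {i. i < n \<and> \<omega> \<in> E i}"
      proof safe
        fix i assume i: "i < n" "q < norm (W \<omega> i)"
        have "norm (W \<omega> i) \<le> norm (S.walk s k i \<omega>) + D"
          using W_close[OF i(1), of \<omega>] norm_triangle_sub[of "W \<omega> i" "S.walk s k i \<omega>"] by linarith
        with i \<omega> show "\<omega> \<in> E i" by (simp add: E_def q_def)
      qed
      then have "card {i. i < n \<and> q < norm (W \<omega> i)} \<le> card {i. i < n \<and> \<omega> \<in> E i}"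
        by (intro card_mono) auto
      also have "\<dots> \<le> m" using \<omega> by (auto simp: bad1_def not_less)
      finally have count: "card {i. i < n \<and> q < norm (W \<omega> i)} \<le> m" .
      have "real n * (A / 4 - D\<^sup>2) \<le> (\<Sum>i<n. (norm (W \<omega> i))\<^sup>2)"
        using \<omega> by (intro sum_norm_square_ge[OF W_close, where c=c and b="4 / w\<^sup>2"]) (auto simp: bad2_def)
      then have "real n * (q / \<epsilon>)\<^sup>2 \<le> (\<Sum>i<n. (norm (W \<omega> i))\<^sup>2)"
        by (simp add: A_def add_divide_distrib)
      then show "\<omega> \<in> T"
        unfolding T_def using \<omega> truncation_ratio_le[OF m(1) q _ count] \<epsilon> by simp
    qed
    then have "measure M (space M - (bad1 \<union> bad2)) \<le> measure M T"
      using T by (rule M.finite_measure_mono)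
    moreover have "measure M (space M - (bad1 \<union> bad2)) = 1 - measure M (bad1 \<union> bad2)"
      using bad1 bad2 by (intro M.prob_compl) auto
    moreover have "measure M (bad1 \<union> bad2) \<le> measure M bad1 + measure M bad2"
      using bad1 bad2 by (intro measure_Un_le)
    ultimately have "1 - \<epsilon> \<le> measure M T" using bad1 bad2 by linarith
    then show "1 - \<epsilon> \<le> measure M {\<omega> \<in> space M.
            (let W = sgd_traj \<pi> h loss \<alpha> \<sigma> n \<eta> (\<lambda>i. \<theta>0 i \<omega>) (\<lambda>k i. X i k \<omega>) (nat \<lfloor>t / \<eta>\<rfloor>)
             in frob n (\<lambda>i. trunc_top n (nat \<lfloor>\<kappa> * real n\<rfloor>) W i - W i) / frob n W \<le> \<epsilon>)}"
      by (simp add: T_def W_def k_def m_def Let_def)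
  qed
qed

end
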